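(* Let $n\ge1$ and let $\lambda$ be a partition with at most $n$ parts, and let $G^{(\beta)}_\lambda(x_1,\dots,x_n)$ be the Grassmannian Grothendieck polynomial. The two formulas $$\text{(a)}\quad G^{(\beta)}_\lambda=\sum_{T\in\mathrm{SVT}_n(\lambda)}\beta^{\mathrm{ex}(T)}x^{\mathrm{wt}(T)},\qquad\qquad \text{(b)}\quad G^{(\beta)}_\lambda=\sum_{P\in\mathcal P^+(\lambda)}x^P$$ are equivalent: each may be deduced from the other, since the bijection $\widetilde\Phi\colon\mathrm{SVT}_n(\lambda)\to\mathcal P^+(\lambda)$, which sends $T$ to the unique $P\in\mathcal P^+(\lambda)$ with $\Psi(P)=\Phi(T)$, matches their summands term by term, i.e. $x^{\widetilde\Phi(T)}=\beta^{\mathrm{ex}(T)}x^{\mathrm{wt}(T)}$ for every $T\in\mathrm{SVT}_n(\lambda)$.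
   Context: Fix $n\ge1$, a partition $\lambda=(\lambda_1\ge\dots\ge\lambda_n\ge0)$, $[n]=\{1,\dots,n\}$, $|\lambda|=\sum_r\lambda_r$. The Young diagram of $\lambda$ (English convention) has cells $(r,c)$, $1\le r\le n$, $1\le c\le\lambda_r$. $G^{(\beta)}_\lambda(x_1,\dots,x_n)$ is the ($\beta$-)Grothendieck polynomial of the Grassmannian permutation attached to $\lambda$; a standard description is $G^{(\beta)}_\lambda=\det\bigl(x_i^{\lambda_j+n-j}(1+\beta x_i)^{j-1}\bigr)_{1\le i,j\le n}\big/\prod_{i<j}(x_i-x_j)$. **Set-valued tableaux.** A set-valued tableau of shape $\lambda$ is a filling $T$ of the cells by non-empty subsets of $[n]$ such that $\max T(r,c)\le\min T(r,c+1)$ and $\max T(r,c)<\min T(r+1,c)$ whenever both cells exist. $\mathrm{SVT}_n(\lambda)$ is the set of these. $\mathrm{wt}(T)_m$ is the number of cells containing $m$, $x^{\mathrm{wt}(T)}=\prod_m x_m^{\mathrm{wt}(T)_m}$, and $\mathrm{ex}(T)=\sum_{(r,c)}(|T(r,c)|-1)$. **Gelfand–Zetlin patterns.** A Gelfand–Zetlin pattern $A$ with top row $\lambda$ is an array of integers $a_{ij}$ ($0\le i\le n-1$, $1\le j\le n-i$) with $a_{0,j}=\lambda_{n+1-j}$ and $a_{i-1,j}\le a_{ij}\le a_{i-1,j+1}$ for $i\ge1$. The upper-left neighbor of $(i,j)$, $i\ge1$, is $(i-1,j)$ and its upper-right neighbor is $(i-1,j+1)$. Chains of partitions $\varnothing=\nu^{(0)}\subseteq\dots\subseteq\nu^{(n)}=\lambda$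 with $\nu^{(k)}_r\ge\nu^{(k-1)}_r\ge\nu^{(k)}_{r+1}$ for all $k,r$ are identified with Gelfand–Zetlin patterns via $a_{ij}=\nu^{(k)}_r$, $k=n-i$, $r=k-j+1$. $\mathrm{Free}(A)$ is the set of positions $(i,j)$, $i\ge1$, with $a_{ij}>a_{i-1,j}$; $\mathcal N(\lambda)$ is the set of pairs $(A,U)$ with $A$ a Gelfand–Zetlin pattern with top row $\lambda$ and $U\subseteq\mathrm{Free}(A)$. **The map $\Phi\colon\mathrm{SVT}_n(\lambda)\to\mathcal N(\lambda)$.** For $T\in\mathrm{SVT}_n(\lambda)$ let $\nu^{(k)}(T)$ be the shape formed by the cells with $\min T(r,c)\le k$; these form a chain of partitions $\varnothing=\nu^{(0)}(T)\subseteq\dots\subseteq\nu^{(n)}(T)=\lambda$ with $\nu^{(k)}_r(T)\ge\nu^{(k-1)}_r(T)\ge\nu^{(k)}_{r+1}(T)$ for all $k,r$, hence a Gelfand–Zetlin pattern via $a_{ij}=\nu^{(k)}_r(T)$, $k=n-i$, $r=k-j+1$. A pair $(k,r)$ with $1\le k\le n-1$, $r\ge1$, is excessive for $T$ if the letter $k+1$ is a non-minimal element of some cell in row $r$. Let $U(T)=\{(n-k,k-r+1):(k,r)\text{ excessive for }T\}$. Then $\Phi(T)=$ (pattern of the chain $\nu^{(\bullet)}(T)$, $U(T)$). **Enhanced patterns.** An enhancement of a Gelfand–Zetlin pattern consists of a set of encircled positions and a set of edges, each edge joining a position $(i,j)$, $i\ge1$, to its upper-left or upper-right neighbor. The pattern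 with enhancement is an enhanced pattern if: (E1) all entries of row $0$ are encircled; (E2) two entries joined by an edge are equal, and the lower one is encircled; (E3) for $1\le i\le n-2$, $1\le j\le n-i-1$: $(i,j)$ and $(i,j+1)$ are both joined by edges to $(i-1,j+1)$ if and only if they are both joined by edges to $(i+1,j)$; (E4) if $a_{0,j}=a_{0,j+1}$, then $(1,j)$ is encircled and joined to both $(0,j)$ and $(0,j+1)$; (E5) if $a_{ij}=a_{i-1,j}<a_{i-1,j+1}$, then $(i,j)$ is encircled and joined by an edge to $(i-1,j)$; (E6) if $a_{i-1,j}<a_{i-1,j+1}=a_{ij}$ and $(i,j)$ is encircled, then $(i,j)$ is joined by an edge to $(i-1,j+1)$; (E7) if $a_{i-1,j}=a_{ij}=a_{i-1,j+1}$ and $(i-1,j)$, $(i-1,j+1)$ can be joined by a path of edges lying in rows $\le i-1$, then $(i,j)$ is encircled and joined to both of them; (E8) if $a_{i-1,j}=a_{ij}=a_{i-1,j+1}$ and $(i,j)$ is encircled, then $(i,j)$ is joined to at least one of $(i-1,j)$, $(i-1,j+1)$. The rank $\operatorname{rk}P$ is the number of entries not encircled. $P$ is inefficient if for some $(i,j)$ with $a_{i-1,j}=a_{ij}=a_{i-1,j+1}$ there is no edge from $(i,j)$ to $(i-1,j+1)$; otherwise efficient. $\mathcal P^+(\lambda)$ is the set of efficient enhanced patterns with top row $\lambda$. **Monomial.** For $P\in\mathcal P^+(\lambda)$, $x^P=\beta^{\operatorname{rk}P}x_1^{d_1}\cdots x_n^{d_n}$ with $d_{n+1-i}=S_{i-1}(P)-S_i(P)+D_i(P)$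 for $1\le i\le n$, where $S_i(P)$ is the sum of entries in row $i$ and $D_i(P)$ the number of non-encircled entries in row $i$ ($S_0=|\lambda|$, $S_n=D_n=0$). **The map $\Psi\colon\mathcal P^+(\lambda)\to\mathcal N(\lambda)$.** $\Psi(P)=$ (underlying pattern of $P$, set of non-encircled positions of $P$). *)

theory Defs
  imports "HOL-Library.Poly_Mapping" "HOL-Library.FuncSet" "Jordan_Normal_Form.Determinant"
begin

section \<open>The Grothendieck polynomial\<close>

text \<open>
  Polynomials in $x_1, x_2, \dots$ over $\mathbf{Z}[\beta]$: an exponent vector \<open>nat \<Rightarrow>\<^sub>0 nat\<close> is
  sent to its coefficient, and \<open>\<beta>\<close> is the variable of the coefficient ring \<open>int poly\<close>.
\<close>

type_synonym gpoly = "(nat \<Rightarrow>\<^sub>0 nat) \<Rightarrow>\<^sub>0 int poly"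

definition beta :: gpoly where
  "beta = Poly_Mapping.single 0 [:0, 1:]"

definition xvar :: "nat \<Rightarrow> gpoly" where
  "xvar m = Poly_Mapping.single (Poly_Mapping.single m 1) 1"

text \<open>
  A partition with at most \<open>n\<close> parts is a function \<open>lam\<close> of which only \<open>lam 1, \<dots>, lam n\<close> matter, with
  \<open>antimono_on {1..n} lam\<close>.  Matrices are indexed from \<open>0\<close>, whence the shifts by one.
\<close>

definition alternant :: "nat \<Rightarrow> (nat \<Rightarrow> nat) \<Rightarrow> gpoly" where
  "alternant n lam = det (mat n n (\<lambda>(i, j).
     xvar (i + 1) ^ (lam (j + 1) + (n - (j + 1))) * (1 + beta * xvar (i + 1)) ^ j))"

definition vandermonde :: "nat \<Rightarrow> gpoly" where
  "vandermonde n = (\<Prod>j\<in>{1..n}. \<Prod>i\<in>{1..<j}. xvar i - xvar j)"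

text \<open>The quotient of the two; the lemma \<open>ex1_grothendieck\<close> below shows that it exists and is unique.\<close>

definition grothendieck :: "nat \<Rightarrow> (nat \<Rightarrow> nat) \<Rightarrow> gpoly" where
  "grothendieck n lam = (THE g. g * vandermonde n = alternant n lam)"

lemma newton_interpolation:
  fixes f :: "'a :: comm_ring_1 poly" and a :: "nat \<Rightarrow> 'a"
  shows "\<exists>c. \<forall>i<n. poly f (a i) = (\<Sum>k\<le>i. (\<Prod>l<k. a i - a l) * c k)"
proof (induction n arbitrary: f a)
  case (Suc n)
  define f1 where "f1 = synthetic_div f (a 0)"
  obtain c where c: "\<And>i. i < n \<Longrightarrow>
      poly f1 (a (Suc i)) = (\<Sum>k\<le>i. (\<Prod>l<k. a (Suc i) - a (Suc l)) * c k)"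
    using Suc.IH[of f1 "\<lambda>i. a (Suc i)"] by blast
  have f: "poly f y = (y - a 0) * poly f1 y + poly f (a 0)" for y
  proof -
    have "poly f y = poly ([:- a 0, 1:] * f1 + [:poly f (a 0):]) y"
      unfolding f1_def by (simp only: synthetic_div_correct')
    then show ?thesis by (simp add: algebra_simps)
  qed
  define d where "d = (\<lambda>k. case k of 0 \<Rightarrow> poly f (a 0) | Suc k \<Rightarrow> c k)"
  have "poly f (a i) = (\<Sum>k\<le>i. (\<Prod>l<k. a i - a l) * d k)" if "i < Suc n" for i
  proof (cases i)
    case 0
    then show ?thesis by (simp add: d_def)
  next
    case (Suc i')
    then have "poly f (a i) = (a i - a 0) *
        (\<Sum>k\<le>i'. (\<Prod>l<k. a i - a (Suc l)) * c k) + poly f (a 0)"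
      using c[of i'] that f[of "a i"] by simp
    also have "\<dots> = (\<Sum>k\<le>i. (\<Prod>l<k. a i - a l) * d k)"
      unfolding Suc sum.atMost_Suc_shift
      by (simp add: d_def prod.lessThan_Suc_shift sum_distrib_left mult.assoc del: prod.lessThan_Suc)
    finally show ?thesis .
  qed
  then show ?case by blast
qed simp

lemma alternant_dvd:
  fixes f :: "nat \<Rightarrow> 'a :: comm_ring_1 poly" and a :: "nat \<Rightarrow> 'a"
  shows "(\<Prod>i<n. \<Prod>l<i. a i - a l) dvd det (mat n n (\<lambda>(i, j). poly (f j) (a i)))"
proof -
  have "\<exists>c. \<forall>j. \<forall>i<n. poly (f j) (a i) = (\<Sum>k\<le>i. (\<Prod>l<k. a i - a l) * c j k)"
    by (rule choice) (use newton_interpolation in blast)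
  then obtain c where
    c: "\<And>j i. i < n \<Longrightarrow> poly (f j) (a i) = (\<Sum>k\<le>i. (\<Prod>l<k. a i - a l) * c j k)"
    by blast
  define L where "L = mat n n (\<lambda>(i, k). \<Prod>l<k. a i - a l)"
  define D where "D = mat n n (\<lambda>(k, j). c j k)"
  have carr: "L \<in> carrier_mat n n" "D \<in> carrier_mat n n"
    by (simp_all add: L_def D_def)
  have zero: "(\<Prod>l<k. a i - a l) = 0" if "i < k" for i k
  proof -
    have "(\<Prod>l\<in>{..<k} - {i}. a i - a l) * (a i - a i) = (\<Prod>l<k. a i - a l)"
      using that by (subst prod.remove[of "{..<k}" i]) (auto simp: mult.commute)
    then show ?thesis by simp
  qed
  have "mat n n (\<lambda>(i, j). poly (f j) (a i)) = L * D"
  proof (rule eq_matI)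
    fix i j assume ij: "i < dim_row (L * D)" "j < dim_col (L * D)"
    then have ij: "i < n" "j < n" by (simp_all add: L_def D_def)
    have "(\<Sum>k\<le>i. (\<Prod>l<k. a i - a l) * c j k) = (\<Sum>k<n. (\<Prod>l<k. a i - a l) * c j k)"
      by (rule sum.mono_neutral_left) (use ij zero in auto)
    then show "mat n n (\<lambda>(i, j). poly (f j) (a i)) $$ (i, j) = (L * D) $$ (i, j)"
      using ij by (simp add: c L_def D_def scalar_prod_def atLeast0LessThan)
  qed (simp_all add: L_def D_def)
  moreover have "det L = (\<Prod>i<n. \<Prod>l<i. a i - a l)"
  proof -
    have "det L = prod_list (diag_mat L)"
      by (rule det_lower_triangular[OF _ carr(1)]) (simp add: L_def zero)
    also have "\<dots> = (\<Prod>i<n. \<Prod>l<i. a i - a l)"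
      by (simp add: prod_list_diag_prod L_def atLeast0LessThan)
    finally show ?thesis .
  qed
  ultimately show ?thesis
    by (simp add: det_mult[OF carr])
qed

lemma xvar_eq_iff: "xvar i = xvar j \<longleftrightarrow> i = j"
proof
  assume "xvar i = xvar j"
  then have "Poly_Mapping.lookup (xvar i) (Poly_Mapping.single i 1)
      = Poly_Mapping.lookup (xvar j) (Poly_Mapping.single i 1)" by simp
  then have "Poly_Mapping.single j (1 :: nat) = Poly_Mapping.single i 1"
    by (auto simp: xvar_def lookup_single when_def split: if_splits)
  then have "Poly_Mapping.lookup (Poly_Mapping.single j (1 :: nat)) i = 1" by simp
  then show "i = j"
    by (auto simp: lookup_single when_def split: if_splits)
qed simp

lemma ex1_grothendieck: "\<exists>!g. g * vandermonde n = alternant n lam"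
proof -
  have nz: "vandermonde n \<noteq> 0"
    by (auto simp: vandermonde_def xvar_eq_iff)
  define f :: "nat \<Rightarrow> gpoly poly" where
    "f j = monom 1 (lam (j + 1) + (n - (j + 1))) * [:1, beta:] ^ j" for j
  have "alternant n lam = det (mat n n (\<lambda>(i, j). poly (f j) (xvar (i + 1))))"
    by (simp add: alternant_def f_def poly_monom mult.commute)
  then have dvd: "(\<Prod>i<n. \<Prod>l<i. xvar (i + 1) - xvar (l + 1)) dvd alternant n lam"
    using alternant_dvd[where f = f and a = "\<lambda>i. xvar (i + 1)"] by simp
  have sh: "(\<Prod>l\<in>{1..<Suc i}. xvar l - xvar (Suc i)) = (\<Prod>l<i. xvar (l + 1) - xvar (i + 1))" for i
    using prod.shift_bounds_nat_ivl[of "\<lambda>l. xvar l - xvar (Suc i)" 0 1 i]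
    by (simp add: atLeast0LessThan)
  have "vandermonde n = (\<Prod>i<n. \<Prod>l<i. xvar (l + 1) - xvar (i + 1))"
    unfolding vandermonde_def
    unfolding One_nat_def prod.atLeast1_atMost_eq using sh by simp
  also have "\<dots> = (\<Prod>i<n. \<Prod>l<i. (- 1) * (xvar (i + 1) - xvar (l + 1)))"
    by simp
  also have "\<dots> = (\<Prod>i<n. (- 1) ^ i) * (\<Prod>i<n. \<Prod>l<i. xvar (i + 1) - xvar (l + 1))"
    by (simp only: prod.distrib prod_constant card_lessThan)
  finally have v: "vandermonde n = (\<Prod>i<n. (- 1) ^ i) * (\<Prod>i<n. \<Prod>l<i. xvar (i + 1) - xvar (l + 1))" .
  have u: "(\<Prod>i<n. (- 1) ^ i) * (\<Prod>i<n. (- 1) ^ i) = (1 :: gpoly)"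
    by (simp flip: prod.distrib power_mult_distrib)
  obtain h where "alternant n lam = (\<Prod>i<n. \<Prod>l<i. xvar (i + 1) - xvar (l + 1)) * h"
    using dvd by (rule dvdE)
  then have "((\<Prod>i<n. (- 1) ^ i) * h) * vandermonde n
      = ((\<Prod>i<n. (- 1) ^ i) * (\<Prod>i<n. (- 1) ^ i)) * alternant n lam"
    unfolding v by (simp only: mult_ac)
  then have "((\<Prod>i<n. (- 1) ^ i) * h) * vandermonde n = alternant n lam"
    unfolding u by simp
  then show ?thesis
    using nz by (metis mult_cancel_right)
qed


section \<open>Set-valued tableaux\<close>

definition cells :: "nat \<Rightarrow> (nat \<Rightarrow> nat) \<Rightarrow> (nat \<times> nat) set" where
  "cells n lam = {(r, c). 1 \<le> r \<and> r \<le> n \<and> 1 \<le> c \<and> c \<le> lam r}"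

type_synonym tableau = "nat \<times> nat \<Rightarrow> nat set"

definition SVT :: "nat \<Rightarrow> (nat \<Rightarrow> nat) \<Rightarrow> tableau set" where
  "SVT n lam = {T \<in> cells n lam \<rightarrow>\<^sub>E {S. S \<noteq> {} \<and> S \<subseteq> {1..n}}.
     (\<forall>r c. (r, c) \<in> cells n lam \<longrightarrow> (r, c + 1) \<in> cells n lam \<longrightarrow>
        Max (T (r, c)) \<le> Min (T (r, c + 1))) \<and>
     (\<forall>r c. (r, c) \<in> cells n lam \<longrightarrow> (r + 1, c) \<in> cells n lam \<longrightarrow>
        Max (T (r, c)) < Min (T (r + 1, c)))}"

definition wt :: "nat \<Rightarrow> (nat \<Rightarrow> nat) \<Rightarrow> tableau \<Rightarrow> nat \<Rightarrow> nat" where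
  "wt n lam T m = card {p \<in> cells n lam. m \<in> T p}"

definition excess :: "nat \<Rightarrow> (nat \<Rightarrow> nat) \<Rightarrow> tableau \<Rightarrow> nat" where
  "excess n lam T = (\<Sum>p\<in>cells n lam. card (T p) - 1)"

definition xwt :: "nat \<Rightarrow> (nat \<Rightarrow> nat) \<Rightarrow> tableau \<Rightarrow> gpoly" where
  "xwt n lam T = (\<Prod>m\<in>{1..n}. xvar m ^ wt n lam T m)"


section \<open>Gelfand--Zetlin patterns\<close>

definition positions :: "nat \<Rightarrow> (nat \<times> nat) set" where
  "positions n = {(i, j). i < n \<and> 1 \<le> j \<and> j \<le> n - i}"

definition lower_positions :: "nat \<Rightarrow> (nat \<times> nat) set" where
  "lower_positions n = {(i, j) \<in> positions n. 1 \<le> i}"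

text \<open>The neighbors of a position in row \<open>0\<close> are junk; they are only used on \<open>lower_positions\<close>.\<close>

fun upper_left :: "nat \<times> nat \<Rightarrow> nat \<times> nat" where
  "upper_left (i, j) = (i - 1, j)"

fun upper_right :: "nat \<times> nat \<Rightarrow> nat \<times> nat" where
  "upper_right (i, j) = (i - 1, j + 1)"

type_synonym pattern = "nat \<times> nat \<Rightarrow> int"

definition GZ :: "nat \<Rightarrow> (nat \<Rightarrow> nat) \<Rightarrow> pattern set" where
  "GZ n lam = {a \<in> positions n \<rightarrow>\<^sub>E UNIV.
     (\<forall>j\<in>{1..n}. a (0, j) = int (lam (n + 1 - j))) \<and>
     (\<forall>p\<in>lower_positions n. a (upper_left p) \<le> a p \<and> a p \<le> a (upper_right p))}"

definition Free :: "nat \<Rightarrow> pattern \<Rightarrow> (nat \<times> nat) set" where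
  "Free n a = {p \<in> lower_positions n. a p > a (upper_left p)}"

definition NN :: "nat \<Rightarrow> (nat \<Rightarrow> nat) \<Rightarrow> (pattern \<times> (nat \<times> nat) set) set" where
  "NN n lam = {(a, U). a \<in> GZ n lam \<and> U \<subseteq> Free n a}"


section \<open>The map from set-valued tableaux to marked patterns\<close>

text \<open>The length of row \<open>r\<close> of the shape formed by the cells with minimum at most \<open>k\<close>.\<close>

definition nu :: "nat \<Rightarrow> (nat \<Rightarrow> nat) \<Rightarrow> tableau \<Rightarrow> nat \<Rightarrow> nat \<Rightarrow> nat" where
  "nu n lam T k r = card {c. (r, c) \<in> cells n lam \<and> Min (T (r, c)) \<le> k}"

text \<open>Entry \<open>(i, j)\<close> is part \<open>r = k - j + 1\<close> of the \<open>k\<close>-th partition of the chain, where \<open>k = n - i\<close>.\<close>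

definition chain_pattern :: "nat \<Rightarrow> (nat \<Rightarrow> nat) \<Rightarrow> tableau \<Rightarrow> pattern" where
  "chain_pattern n lam T =
     restrict (\<lambda>(i, j). int (nu n lam T (n - i) (n - i - j + 1))) (positions n)"

definition excessive :: "nat \<Rightarrow> (nat \<Rightarrow> nat) \<Rightarrow> tableau \<Rightarrow> nat \<Rightarrow> nat \<Rightarrow> bool" where
  "excessive n lam T k r \<longleftrightarrow> 1 \<le> k \<and> k \<le> n - 1 \<and> 1 \<le> r \<and>
     (\<exists>c. (r, c) \<in> cells n lam \<and> k + 1 \<in> T (r, c) \<and> k + 1 \<noteq> Min (T (r, c)))"

text \<open>Excessive pairs satisfy \<open>r \<le> k\<close>, so the subtraction below does not truncate.\<close>

definition marked :: "nat \<Rightarrow> (nat \<Rightarrow> nat) \<Rightarrow> tableau \<Rightarrow> (nat \<times> nat) set" where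
  "marked n lam T = {(n - k, k - r + 1) | k r. excessive n lam T k r}"

definition Phi :: "nat \<Rightarrow> (nat \<Rightarrow> nat) \<Rightarrow> tableau \<Rightarrow> pattern \<times> (nat \<times> nat) set" where
  "Phi n lam T = (chain_pattern n lam T, marked n lam T)"


section \<open>Enhanced patterns\<close>

text \<open>An edge is an ordered pair: its lower end, followed by a neighbor in the row above.\<close>

record enh_pattern =
  entry :: pattern
  circ :: "(nat \<times> nat) set"
  edges :: "((nat \<times> nat) \<times> (nat \<times> nat)) set"

definition enhancement :: "nat \<Rightarrow> enh_pattern \<Rightarrow> bool" where
  "enhancement n P \<longleftrightarrow> circ P \<subseteq> positions n \<and>
     (\<forall>(p, q)\<in>edges P. p \<in> lower_positions n \<and> (q = upper_left p \<or> q = upper_right p))"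

text \<open>Undirected paths all of whose edges lie in rows \<open>\<le> m\<close>.\<close>

definition path_connected_upto ::
    "enh_pattern \<Rightarrow> nat \<Rightarrow> nat \<times> nat \<Rightarrow> nat \<times> nat \<Rightarrow> bool" where
  "path_connected_upto P m p q \<longleftrightarrow>
     (let R = {(u, v) \<in> edges P. fst u \<le> m \<and> fst v \<le> m} in (p, q) \<in> (R \<union> R\<inverse>)\<^sup>*)"

definition E1 :: "nat \<Rightarrow> enh_pattern \<Rightarrow> bool" where
  "E1 n P \<longleftrightarrow> (\<forall>j\<in>{1..n}. (0, j) \<in> circ P)"

definition E2 :: "nat \<Rightarrow> enh_pattern \<Rightarrow> bool" where
  "E2 n P \<longleftrightarrow> (\<forall>(p, q)\<in>edges P. entry P p = entry P q \<and> p \<in> circ P)"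

definition E3 :: "nat \<Rightarrow> enh_pattern \<Rightarrow> bool" where
  "E3 n P \<longleftrightarrow> (\<forall>i j. 1 \<le> i \<and> i + 2 \<le> n \<and> 1 \<le> j \<and> i + j + 1 \<le> n \<longrightarrow>
     (((i, j), (i - 1, j + 1)) \<in> edges P \<and> ((i, j + 1), (i - 1, j + 1)) \<in> edges P \<longleftrightarrow>
      ((i + 1, j), (i, j)) \<in> edges P \<and> ((i + 1, j), (i, j + 1)) \<in> edges P))"

definition E4 :: "nat \<Rightarrow> enh_pattern \<Rightarrow> bool" where
  "E4 n P \<longleftrightarrow> (\<forall>j. 1 \<le> j \<and> j + 1 \<le> n \<and> entry P (0, j) = entry P (0, j + 1) \<longrightarrow>
     (1, j) \<in> circ P \<and> ((1, j), (0, j)) \<in> edges P \<and> ((1, j), (0, j + 1)) \<in> edges P)"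

definition E5 :: "nat \<Rightarrow> enh_pattern \<Rightarrow> bool" where
  "E5 n P \<longleftrightarrow> (\<forall>p\<in>lower_positions n.
     entry P p = entry P (upper_left p) \<and> entry P (upper_left p) < entry P (upper_right p) \<longrightarrow>
     p \<in> circ P \<and> (p, upper_left p) \<in> edges P)"

definition E6 :: "nat \<Rightarrow> enh_pattern \<Rightarrow> bool" where
  "E6 n P \<longleftrightarrow> (\<forall>p\<in>lower_positions n.
     entry P (upper_left p) < entry P (upper_right p) \<and> entry P (upper_right p) = entry P p \<and>
     p \<in> circ P \<longrightarrow> (p, upper_right p) \<in> edges P)"

definition E7 :: "nat \<Rightarrow> enh_pattern \<Rightarrow> bool" where
  "E7 n P \<longleftrightarrow> (\<forall>p\<in>lower_positions n.
     entry P (upper_left p) = entry P p \<and> entry P p = entry P (upper_right p) \<and>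
     path_connected_upto P (fst p - 1) (upper_left p) (upper_right p) \<longrightarrow>
     p \<in> circ P \<and> (p, upper_left p) \<in> edges P \<and> (p, upper_right p) \<in> edges P)"

definition E8 :: "nat \<Rightarrow> enh_pattern \<Rightarrow> bool" where
  "E8 n P \<longleftrightarrow> (\<forall>p\<in>lower_positions n.
     entry P (upper_left p) = entry P p \<and> entry P p = entry P (upper_right p) \<and> p \<in> circ P \<longrightarrow>
     (p, upper_left p) \<in> edges P \<or> (p, upper_right p) \<in> edges P)"

definition enhanced_patterns :: "nat \<Rightarrow> (nat \<Rightarrow> nat) \<Rightarrow> enh_pattern set" where
  "enhanced_patterns n lam = {P. entry P \<in> GZ n lam \<and> enhancement n P \<and>
     E1 n P \<and> E2 n P \<and> E3 n P \<and> E4 n P \<and> E5 n P \<and> E6 n P \<and> E7 n P \<and> E8 n P}"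

definition inefficient :: "nat \<Rightarrow> enh_pattern \<Rightarrow> bool" where
  "inefficient n P \<longleftrightarrow> (\<exists>p\<in>lower_positions n.
     entry P (upper_left p) = entry P p \<and> entry P p = entry P (upper_right p) \<and>
     (p, upper_right p) \<notin> edges P)"

definition Pplus :: "nat \<Rightarrow> (nat \<Rightarrow> nat) \<Rightarrow> enh_pattern set" where
  "Pplus n lam = {P \<in> enhanced_patterns n lam. \<not> inefficient n P}"

definition rk :: "nat \<Rightarrow> enh_pattern \<Rightarrow> nat" where
  "rk n P = card (positions n - circ P)"

definition row_sum :: "nat \<Rightarrow> enh_pattern \<Rightarrow> nat \<Rightarrow> int" where
  "row_sum n P i = (\<Sum>j\<in>{1..n - i}. entry P (i, j))"

definition row_free :: "nat \<Rightarrow> enh_pattern \<Rightarrow> nat \<Rightarrow> nat" where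
  "row_free n P i = card {j \<in> {1..n - i}. (i, j) \<notin> circ P}"

definition xdeg :: "nat \<Rightarrow> enh_pattern \<Rightarrow> nat \<Rightarrow> int" where
  "xdeg n P m = (let i = n + 1 - m in row_sum n P (i - 1) - row_sum n P i + int (row_free n P i))"

text \<open>The conversion to \<open>nat\<close> does not truncate: see \<open>xdeg_nonneg\<close> below.\<close>

definition xP :: "nat \<Rightarrow> enh_pattern \<Rightarrow> gpoly" where
  "xP n P = beta ^ rk n P * (\<Prod>m\<in>{1..n}. xvar m ^ nat (xdeg n P m))"

definition Psi :: "nat \<Rightarrow> enh_pattern \<Rightarrow> pattern \<times> (nat \<times> nat) set" where
  "Psi n P = (entry P, positions n - circ P)"

definition Phi_tilde :: "nat \<Rightarrow> (nat \<Rightarrow> nat) \<Rightarrow> tableau \<Rightarrow> enh_pattern" where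
  "Phi_tilde n lam T = (THE P. P \<in> Pplus n lam \<and> Psi n P = Phi n lam T)"


section \<open>Consistency of the definitions\<close>

lemma finite_SVT: "finite (SVT n lam)"
proof -
  have "cells n lam \<subseteq> (SIGMA r:{1..n}. {1..lam r})"
    by (auto simp: cells_def)
  then have "finite (cells n lam)"
    by (rule finite_subset) auto
  moreover have "finite {S. S \<noteq> {} \<and> S \<subseteq> {1..n}}"
    by (rule finite_subset[of _ "Pow {1..n}"]) auto
  ultimately show ?thesis
    unfolding SVT_def by (simp add: finite_PiE)
qed

lemma xdeg_nonneg:
  assumes a: "entry P \<in> GZ n lam" and m: "m \<in> {1..n}"
  shows "0 \<le> xdeg n P m"
proof -
  define i where "i = n - m"
  have i: "n + 1 - m = Suc i" "i < n" "n - i = Suc (n - Suc i)"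
    using m by (auto simp: i_def)
  have nonneg: "0 \<le> entry P (i, 1)" if "i < n" for i
    using that
  proof (induction i)
    case 0
    then show ?case using a by (auto simp: GZ_def)
  next
    case (Suc i)
    then have "(Suc i, 1) \<in> lower_positions n"
      by (auto simp: lower_positions_def positions_def)
    then have "entry P (i, 1) \<le> entry P (Suc i, 1)"
      using a by (fastforce simp: GZ_def)
    then show ?case using Suc by simp
  qed
  have "row_sum n P (Suc i) \<le> (\<Sum>j\<in>{1..n - Suc i}. entry P (i, Suc j))"
    unfolding row_sum_def
  proof (rule sum_mono)
    fix j assume "j \<in> {1..n - Suc i}"
    then have "(Suc i, j) \<in> lower_positions n"
      by (auto simp: lower_positions_def positions_def)
    then show "entry P (Suc i, j) \<le> entry P (i, Suc j)"
      using a by (fastforce simp: GZ_def)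
  qed
  also have "\<dots> = (\<Sum>j\<in>{Suc 1..Suc (n - Suc i)}. entry P (i, j))"
    by (subst sum.shift_bounds_cl_Suc_ivl) simp
  also have "\<dots> \<le> row_sum n P i"
    unfolding row_sum_def i(3) using nonneg[OF i(2)]
    by (subst (2) sum.atLeast_Suc_atMost) auto
  finally show ?thesis
    unfolding xdeg_def i(1) Let_def by simp
qed

lemma Psi_in_NN:
  assumes "P \<in> Pplus n lam"
  shows "Psi n P \<in> NN n lam"
proof -
  have gz: "entry P \<in> GZ n lam" and e: "E1 n P" "E2 n P" "E5 n P" and eff: "\<not> inefficient n P"
    using assms by (auto simp: Pplus_def enhanced_patterns_def)
  have "p \<in> Free n (entry P)" if p: "p \<in> positions n" "p \<notin> circ P" for p
  proof -
    obtain i j where [simp]: "p = (i, j)" by fastforce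
    have low: "p \<in> lower_positions n"
      using p e(1) by (cases i) (auto simp: E1_def positions_def lower_positions_def)
    then have le: "entry P (upper_left p) \<le> entry P p" "entry P p \<le> entry P (upper_right p)"
      using gz by (auto simp: GZ_def)
    have "entry P p \<noteq> entry P (upper_left p)"
    proof
      assume eq: "entry P p = entry P (upper_left p)"
      then have "(p, upper_right p) \<notin> edges P"
        using e(2) p by (auto simp: E2_def)
      then have "entry P p \<noteq> entry P (upper_right p)"
        using eff eq low unfolding inefficient_def by metis
      then show False
        using e(3) eq low p le unfolding E5_def by force
    qed
    then show ?thesis using low le by (simp add: Free_def)
  qed
  then show ?thesis
    using gz by (auto simp: Psi_def NN_def)
qed

lemma Phi_in_NN:
  assumes lam: "antimono_on {1..n} lam" and T: "T \<in> SVT n lam"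
  shows "Phi n lam T \<in> NN n lam"
proof -
  have ne: "T p \<noteq> {}" "T p \<subseteq> {1..n}" "finite (T p)" if "p \<in> cells n lam" for p
  proof -
    show *: "T p \<noteq> {}" "T p \<subseteq> {1..n}"
      using T that by (auto simp: SVT_def dest!: PiE_mem[OF _ that])
    then show "finite (T p)" using finite_subset by blast
  qed
  have up: "(r, c) \<in> cells n lam" if "(r + 1, c) \<in> cells n lam" "1 \<le> r" for r c
  proof -
    have "lam (r + 1) \<le> lam r"
      using that by (intro monotone_onD[OF lam]) (auto simp: cells_def)
    then show ?thesis using that by (auto simp: cells_def)
  qed
  have col: "Max (T (r, c)) < Min (T (r + 1, c))" if "(r + 1, c) \<in> cells n lam" "1 \<le> r" for r c
    using T that up[OF that] by (auto simp: SVT_def)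
  have mm: "Min (T p) \<le> Max (T p)" if "p \<in> cells n lam" for p
    using ne[OF that] by (intro Max.coboundedI) auto
  have minr: "r \<le> Min (T (r, c))" if "(r, c) \<in> cells n lam" for r c
    using that
  proof (induction r)
    case (Suc r)
    show ?case
    proof (cases "r = 0")
      case True
      then show ?thesis
        using ne[OF Suc.prems] Min_in[of "T (Suc r, c)"] by auto
    next
      case False
      then show ?thesis
        using Suc up[of r c] col[of r c] mm[of "(r, c)"] by auto
    qed
  qed simp
  define row where "row = (\<lambda>k r. {c. (r, c) \<in> cells n lam \<and> Min (T (r, c)) \<le> k})"
  have nu: "nu n lam T k r = card (row k r)" for k r
    by (simp add: nu_def row_def)
  have fin: "finite (row k r)" for k r
    by (rule finite_subset[of _ "{1..lam r}"]) (auto simp: row_def cells_def)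
  have sub1: "row k r \<subseteq> row (Suc k) r" for k r
    by (auto simp: row_def)
  have sub2: "row (Suc k) (Suc r) \<subseteq> row k r" if "1 \<le> r" for k r
    using that up[of r] col[of r] mm by (fastforce simp: row_def)
  have low: "\<exists>k r. i = n - k \<and> j = k - r + 1 \<and> k < n \<and> 1 \<le> r \<and> r \<le> k \<and>
      n - i = k \<and> n - i - j + 1 = r \<and> n - (i - 1) = Suc k \<and> n - (i - 1) - j + 1 = Suc r \<and>
      n - (i - 1) - (j + 1) + 1 = r \<and> (i, j) \<in> positions n \<and>
      (i - 1, j) \<in> positions n \<and> (i - 1, j + 1) \<in> positions n"
    if "(i, j) \<in> lower_positions n" for i j
    using that
    by (intro exI[of _ "n - i"] exI[of _ "n - i - j + 1"])
       (auto simp: lower_positions_def positions_def)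
  have "chain_pattern n lam T \<in> GZ n lam"
    unfolding GZ_def
  proof (intro CollectI conjI ballI)
    show "chain_pattern n lam T \<in> positions n \<rightarrow>\<^sub>E UNIV"
      by (auto simp: chain_pattern_def)
  next
    fix j assume j: "j \<in> {1..n}"
    have "row n r = {1..lam r}" if "1 \<le> r" "r \<le> n" for r
    proof -
      have "Min (T (r, c)) \<le> n" if "(r, c) \<in> cells n lam" for c
        using ne[OF that] Min_in[OF ne(3)[OF that] ne(1)[OF that]] by (meson subsetD atLeastAtMost_iff)
      then show ?thesis using that by (auto simp: row_def cells_def)
    qed
    from this[of "n + 1 - j"] j have "nu n lam T n (n + 1 - j) = lam (n + 1 - j)"
      by (auto simp: nu)
    then show "chain_pattern n lam T (0, j) = int (lam (n + 1 - j))"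
      using j by (auto simp: chain_pattern_def positions_def Suc_diff_le)
  next
    fix p assume p: "p \<in> lower_positions n"
    obtain i j where [simp]: "p = (i, j)" by fastforce
    have "(i, j) \<in> lower_positions n" using p by simp
    from low[OF this] obtain k r where kr: "1 \<le> r"
      "n - i = k" "n - i - j + 1 = r" "n - (i - 1) = Suc k" "n - (i - 1) - j + 1 = Suc r"
      "n - (i - 1) - (j + 1) + 1 = r" "(i, j) \<in> positions n"
      "(i - 1, j) \<in> positions n" "(i - 1, j + 1) \<in> positions n" by blast
    have e: "chain_pattern n lam T p = int (card (row k r))"
      "chain_pattern n lam T (upper_left p) = int (card (row (Suc k) (Suc r)))"
      "chain_pattern n lam T (upper_right p) = int (card (row (Suc k) r))"
      using kr by (simp_all only: \<open>p = (i, j)\<close> upper_left.simps upper_right.simps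
          chain_pattern_def nu restrict_apply' prod.case)
    show "chain_pattern n lam T (upper_left p) \<le> chain_pattern n lam T p"
      unfolding e using sub2[OF kr(1)] fin by (simp add: card_mono)
    show "chain_pattern n lam T p \<le> chain_pattern n lam T (upper_right p)"
      unfolding e using sub1 fin by (simp add: card_mono)
  qed
  moreover have "marked n lam T \<subseteq> Free n (chain_pattern n lam T)"
  proof
    fix p assume "p \<in> marked n lam T"
    then obtain k r where p: "p = (n - k, k - r + 1)" and ex: "excessive n lam T k r"
      by (auto simp: marked_def)
    from ex obtain c where k: "1 \<le> k" "k \<le> n - 1" "1 \<le> r" and
      c: "(r, c) \<in> cells n lam" "k + 1 \<in> T (r, c)" "k + 1 \<noteq> Min (T (r, c))"
      by (auto simp: excessive_def)
    have min: "Min (T (r, c)) \<le> k"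
      using Min_le[OF ne(3)[OF c(1)] c(2)] c(3) by simp
    then have rk: "r \<le> k" using minr[OF c(1)] by simp
    have pos: "p \<in> lower_positions n" "(n - k, k - r + 1) \<in> positions n"
      "(n - k - 1, k - r + 1) \<in> positions n"
      using k rk by (auto simp: p lower_positions_def positions_def)
    have "c \<in> row k r" using c min by (simp add: row_def)
    moreover have "c \<notin> row (Suc k) (Suc r)"
    proof
      assume "c \<in> row (Suc k) (Suc r)"
      then have "Max (T (r, c)) < Suc k"
        using col[of r c] k by (auto simp: row_def)
      moreover have "k + 1 \<le> Max (T (r, c))"
        using Max_ge[OF ne(3)[OF c(1)] c(2)] .
      ultimately show False by simp
    qed
    ultimately have "row (Suc k) (Suc r) \<subset> row k r"
      using sub2[OF k(3)] by blast
    then have "card (row (Suc k) (Suc r)) < card (row k r)"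
      by (rule psubset_card_mono[OF fin])
    moreover have "chain_pattern n lam T p = int (card (row k r))"
      using pos k rk by (simp add: p chain_pattern_def nu)
    moreover have "chain_pattern n lam T (upper_left p) = int (card (row (Suc k) (Suc r)))"
    proof -
      have "n - (n - k - 1) = Suc k" "Suc k - (k - r + 1) + 1 = Suc r"
        using k rk by auto
      then show ?thesis
        using pos by (simp only: p upper_left.simps chain_pattern_def nu restrict_apply' prod.case)
    qed
    ultimately show "p \<in> Free n (chain_pattern n lam T)"
      using pos by (simp add: Free_def)
  qed
  ultimately show ?thesis
    by (simp add: Phi_def NN_def)
qed

end

theory Submission
  imports Defs
begin

text \<open>
  Both maps into the marked patterns \<open>NN\<close> have explicit inverses, and along these inverses the two
  monomials can be compared letter by letter.

  On the side of enhanced patterns, the conditions leave no choice of edges once the entries and the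
  set \<open>U\<close> of non-encircled positions are known. An edge to the upper right neighbor is present exactly
  when the two entries agree and the lower one is encircled, by (E6) and efficiency. An edge to the
  upper left neighbor requires equal entries; it is forced by (E5) if the upper right entry is larger
  and by (E4) in row one, and otherwise (E3) reduces it to edges one row higher. This recursion
  defines \<open>left_edge\<close> and \<open>pattern_of\<close>. That \<open>pattern_of\<close> satisfies all the conditions is
  immediate except for (E7), where paths enter: if two equal neighbors in a row are not
  both joined to the position above and between them, a cut running upwards between the two
  separates them, so no path can connect them (\<open>cut_between_neighbors\<close>).

  On the side of tableaux, write \<open>\<nu>\<^bsup>k\<^esup>\<close> for the chain of shapes. In row \<open>r\<close> the letter \<open>k + 1\<close> is
  the minimum of the cells in columns \<open>\<nu>\<^bsup>k\<^esup>\<^sub>r < c \<le> \<nu>\<^bsup>k+1\<^esup>\<^sub>r\<close>. It can be a non-minimal element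
  only of the last cell whose minimum is at most \<open>k\<close>, the one in column \<open>\<nu>\<^bsup>k\<^esup>\<^sub>r\<close>: any cell further
  left has such a cell to its right, all of whose letters would have to be at least \<open>k + 1\<close>. So one bit
  for each pair \<open>(k, r)\<close>, the mark, recovers the tableau (\<open>tableau_of_Phi\<close>). Conversely a mark at
  \<open>(k, r)\<close> is compatible with the strict increase down column \<open>\<nu>\<^bsup>k\<^esup>\<^sub>r\<close> because a free position means
  \<open>\<nu>\<^bsup>k\<^esup>\<^sub>r > \<nu>\<^bsup>k+1\<^esup>\<^bsub>r+1\<^esub>\<close> (\<open>tableau_of_in_SVT\<close>).

  This description also gives the weights: the letter \<open>k + 1\<close> occurs
  \<open>\<nu>\<^bsup>k+1\<^esup>\<^sub>r - \<nu>\<^bsup>k\<^esup>\<^sub>r\<close> times in row \<open>r\<close>, and once more if \<open>(k, r)\<close> is marked. Summation over \<open>r\<close> turns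
  this into the difference of two row sums of the pattern plus a number of non-encircled entries, which
  is the exponent in \<open>xP\<close>. The exponents of \<open>\<beta>\<close> then agree because the excess is the total weight
  minus the number of cells, and the row sums telescope.
\<close>

section \<open>Efficient enhanced patterns as marked patterns\<close>

text \<open>
  The edge from \<open>(i, j)\<close> to \<open>(i - 1, j)\<close> that an efficient enhanced pattern with entries \<open>a\<close> and
  non-encircled positions \<open>U\<close> must have. The three disjuncts are the cases governed by (E5), (E4)
  and (E3).
\<close>

fun left_edge :: "pattern \<Rightarrow> (nat \<times> nat) set \<Rightarrow> nat \<Rightarrow> nat \<Rightarrow> bool" where
  "left_edge a U 0 j \<longleftrightarrow> False"
| "left_edge a U (Suc i) j \<longleftrightarrow> a (Suc i, j) = a (i, j) \<and>
     (a (i, j) < a (i, j + 1) \<or> i = 0 \<or>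
      a (i, j) = a (i - 1, j + 1) \<and> (i, j) \<notin> U \<and> left_edge a U i (j + 1))"

definition pattern_of :: "nat \<Rightarrow> pattern \<Rightarrow> (nat \<times> nat) set \<Rightarrow> enh_pattern" where
  "pattern_of n a U = \<lparr>entry = a, circ = positions n - U,
     edges = {((i, j), (i - 1, j)) | i j. (i, j) \<in> lower_positions n \<and> left_edge a U i j} \<union>
       {((i, j), (i - 1, j + 1)) | i j. (i, j) \<in> lower_positions n \<and>
          a (i, j) = a (i - 1, j + 1) \<and> (i, j) \<notin> U}\<rparr>"

lemma lower_positions_iff: "(i, j) \<in> lower_positions n \<longleftrightarrow> 1 \<le> i \<and> i < n \<and> 1 \<le> j \<and> j \<le> n - i"
  by (auto simp: lower_positions_def positions_def)

lemma pattern_of_simps [simp]: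
  "entry (pattern_of n a U) = a" "circ (pattern_of n a U) = positions n - U"
  by (simp_all add: pattern_of_def)

lemma left_in_edges_pattern_of:
  "((i, j), (i - Suc 0, j)) \<in> edges (pattern_of n a U) \<longleftrightarrow>
     (i, j) \<in> lower_positions n \<and> left_edge a U i j"
  by (auto simp: pattern_of_def)

lemma right_in_edges_pattern_of:
  "((i, j), (i - Suc 0, Suc j)) \<in> edges (pattern_of n a U) \<longleftrightarrow>
     (i, j) \<in> lower_positions n \<and> a (i, j) = a (i - 1, Suc j) \<and> (i, j) \<notin> U"
  by (auto simp: pattern_of_def)

lemma GZ_interlacing:
  assumes "a \<in> GZ n lam" "(i, j) \<in> lower_positions n"
  shows "a (i - 1, j) \<le> a (i, j)" "a (i, j) \<le> a (i - 1, Suc j)"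
  using assms by (force simp: GZ_def)+

lemma left_edgeD:
  assumes "left_edge a U i j"
  shows "i \<ge> 1" "a (i, j) = a (i - 1, j)"
  using assms by (cases i; simp)+

text \<open>
  The lower ends of upper left edges, and the positions that (E4), (E5) and (E7) speak of, have to be
  encircled. All of them agree with their upper left neighbor, so they are not free.
\<close>

lemma not_marked:
  assumes "U \<subseteq> Free n a" "a (i, j) = a (i - 1, j)"
  shows "(i, j) \<notin> U"
  using assms by (auto simp: Free_def)

text \<open>
  The set \<open>S\<close> is one side of a cut: a union of components of the graph formed by the edges in rows
  \<open>\<le> m\<close>. If \<open>(m, j)\<close> is not encircled, it is isolated in that graph, and \<open>S\<close> is this single position.
  Otherwise the edge from \<open>(m, j + 1)\<close> to its upper left neighbor \<open>(m - 1, j + 1)\<close> is missing. By the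
  recursion for \<open>left_edge\<close> this is due to a missing edge one row higher, which gives a cut between
  \<open>(m - 1, j + 1)\<close> and \<open>(m - 1, j + 2)\<close>. It is extended by the positions of row \<open>m\<close> attached to it.
  By (E3), a position in row \<open>m\<close> joined to both of its upper neighbors joins two positions that are
  already on the same side.
\<close>

lemma cut_between_neighbors:
  assumes a: "a \<in> GZ n lam" and U: "U \<subseteq> Free n a"
    and m: "1 \<le> m" "1 \<le> j" "m + j + 1 \<le> n"
    and eq: "a (m, j) = a (m, Suc j)"
    and no: "\<not> (a (m, j) = a (m - 1, Suc j) \<and> (m, j) \<notin> U \<and> left_edge a U m (Suc j))"
  shows "\<exists>S. (m, j) \<in> S \<and> (m, Suc j) \<notin> S \<and> (\<forall>p\<in>S. fst p \<le> m) \<and>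
     (\<forall>(u, v)\<in>edges (pattern_of n a U). fst u \<le> m \<longrightarrow> (u \<in> S \<longleftrightarrow> v \<in> S))"
  using m eq no
proof (induction m arbitrary: j)
  case 0
  then show ?case by simp
next
  case (Suc m)
  let ?E = "edges (pattern_of n a U)"
  have low: "(Suc m, j) \<in> lower_positions n" "(Suc m, Suc j) \<in> lower_positions n"
    using Suc.prems by (auto simp: lower_positions_iff)
  have mid: "a (Suc m, j) = a (m, Suc j)" "a (Suc m, Suc j) = a (m, Suc j)"
    using GZ_interlacing[OF a low(1)] GZ_interlacing[OF a low(2)] Suc.prems(4) by auto
  show ?case
  proof (cases "(Suc m, j) \<in> U")
    case True
    have "left_edge a U (Suc m) j = False"
      using not_marked[OF U, of "Suc m" j] left_edgeD(2)[of a U "Suc m" j] True by blast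
    then show ?thesis using True
      by (intro exI[of _ "{(Suc m, j)}"]) (auto simp: pattern_of_def)
  next
    case False
    then have nl: "\<not> left_edge a U (Suc m) (Suc j)" using mid Suc.prems(5) by simp
    \<comment> \<open>In row one, or next to a larger entry, the missing edge would be present.\<close>
    have tri: "a (m, Suc j) = a (m, Suc (Suc j))"
      and m0: "m \<noteq> 0"
      and no': "\<not> (a (m, Suc j) = a (m - 1, Suc (Suc j)) \<and> (m, Suc j) \<notin> U \<and> left_edge a U m (Suc (Suc j)))"
      using nl mid GZ_interlacing[OF a low(2)] by auto
    have "1 \<le> m" "1 \<le> Suc j" "m + Suc j + 1 \<le> n"
      using Suc.prems m0 by auto
    note Suc.IH[OF this tri no']
    then obtain S where
      S: "(m, Suc j) \<in> S" "(m, Suc (Suc j)) \<notin> S" "\<forall>p\<in>S. fst p \<le> m"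
      and "\<forall>(u, v)\<in>?E. fst u \<le> m \<longrightarrow> (u \<in> S \<longleftrightarrow> v \<in> S)"
      by blast
    then have cl: "u \<in> S \<longleftrightarrow> v \<in> S" if "(u, v) \<in> ?E" "fst u \<le> m" for u v
      using that by blast
    define S' where "S' = S \<union> {u. fst u = Suc m \<and> (\<exists>v\<in>S. (u, v) \<in> ?E)}"
    \<comment> \<open>The condition (E3): the two ends of such a detour have a common upper neighbor.\<close>
    have top: "(m, t) \<in> S \<longleftrightarrow> (m, Suc t) \<in> S"
      if l: "((Suc m, t), (m, t)) \<in> ?E" and r: "((Suc m, t), (m, Suc t)) \<in> ?E" for t
    proof -
      have l': "(Suc m, t) \<in> lower_positions n" "left_edge a U (Suc m) t"
        using left_in_edges_pattern_of[of "Suc m" t n a U] l by auto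
      have r': "a (Suc m, t) = a (m, Suc t)"
        using right_in_edges_pattern_of[of "Suc m" t n a U] r by auto
      have "a (m, t) = a (m - 1, Suc t)" "(m, t) \<notin> U" "left_edge a U m (Suc t)"
        using l' r' m0 by auto
      moreover have "(m, t) \<in> lower_positions n" "(m, Suc t) \<in> lower_positions n"
        using l'(1) m0 by (auto simp: lower_positions_iff)
      ultimately have "((m, t), (m - 1, Suc t)) \<in> ?E" "((m, Suc t), (m - 1, Suc t)) \<in> ?E"
        using right_in_edges_pattern_of[of m t n a U] left_in_edges_pattern_of[of m "Suc t" n a U]
        by auto
      then show ?thesis using cl by fastforce
    qed
    have "(u \<in> S' \<longleftrightarrow> v \<in> S')" if e: "(u, v) \<in> ?E" "fst u \<le> Suc m" for u v
    proof -
      obtain i t where u: "u = (i, t)" and v: "v = (i - 1, t) \<or> v = (i - 1, Suc t)"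
        and i: "i \<ge> 1"
        using e(1) by (auto simp: pattern_of_def lower_positions_iff)
      show ?thesis
      proof (cases "i = Suc m")
        case False
        then show ?thesis using e cl[OF e(1)] v i by (auto simp: S'_def u)
      next
        case True
        have v': "v = (m, t) \<or> v = (m, Suc t)" using v True by simp
        have uS: "u \<notin> S" using S(3) True u by auto
        have "u \<in> S' \<longleftrightarrow> (\<exists>w\<in>S. (u, w) \<in> ?E)" using uS True u by (auto simp: S'_def)
        also have "\<dots> \<longleftrightarrow> v \<in> S"
        proof
          assume "\<exists>w\<in>S. (u, w) \<in> ?E"
          then obtain w where w: "w \<in> S" "(u, w) \<in> ?E" by blast
          then have "w = (m, t) \<or> w = (m, Suc t)"
            using True u by (auto simp: pattern_of_def)
          then show "v \<in> S" using v' w e(1) top[of t] u True by auto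
        qed (use e in auto)
        also have "\<dots> \<longleftrightarrow> v \<in> S'" using v' by (auto simp: S'_def)
        finally show ?thesis .
      qed
    qed
    moreover have "(Suc m, j) \<in> S'"
      using S(1) right_in_edges_pattern_of[of "Suc m" j n a U] low mid False
      by (auto simp: S'_def)
    moreover have "(Suc m, Suc j) \<notin> S'"
      using S(2,3) nl by (auto simp: S'_def pattern_of_def)
    moreover have "\<forall>p\<in>S'. fst p \<le> Suc m" using S(3) by (auto simp: S'_def)
    ultimately show ?thesis by (intro exI[of _ S']) auto
  qed
qed

lemma path_connected_upto_closed:
  assumes "path_connected_upto P m p q"
    and "\<forall>(u, v)\<in>edges P. fst u \<le> m \<longrightarrow> (u \<in> S \<longleftrightarrow> v \<in> S)"
  shows "p \<in> S \<longleftrightarrow> q \<in> S"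
proof -
  have "(p, q) \<in> ({(u, v) \<in> edges P. fst u \<le> m \<and> fst v \<le> m} \<union>
      {(u, v) \<in> edges P. fst u \<le> m \<and> fst v \<le> m}\<inverse>)\<^sup>*"
    using assms(1) by (simp add: path_connected_upto_def Let_def)
  then show ?thesis
    by (induction rule: rtrancl_induct) (use assms(2) in auto)
qed

text \<open>
  In rows above the first, the two upper neighbors of \<open>(i, j)\<close> can only be connected if the edges
  that (E3) asks for are there, since otherwise the cut separates them.
\<close>

lemma pattern_of_E7:
  assumes a: "a \<in> GZ n lam" and U: "U \<subseteq> Free n a"
  shows "E7 n (pattern_of n a U)"
  unfolding E7_def
proof (intro ballI impI)
  fix p assume p: "p \<in> lower_positions n"
  obtain i j where [simp]: "p = (i, j)" by fastforce
  let ?P = "pattern_of n a U"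
  assume "entry ?P (upper_left p) = entry ?P p \<and> entry ?P p = entry ?P (upper_right p) \<and>
    path_connected_upto ?P (fst p - 1) (upper_left p) (upper_right p)"
  then have eq: "a (i - 1, j) = a (i, j)" "a (i, j) = a (i - 1, Suc j)"
    and pc: "path_connected_upto ?P (i - 1) (i - 1, j) (i - 1, Suc j)" by auto
  have pos: "1 \<le> i" "i < n" "1 \<le> j" "j \<le> n - i" using p by (auto simp: lower_positions_iff)
  have nU: "(i, j) \<notin> U" using not_marked[OF U, of i j] eq by simp
  have "left_edge a U i j"
  proof (cases "i = 1")
    case True
    then show ?thesis using eq by simp
  next
    case False
    then obtain m where i: "i = Suc m" "1 \<le> m" using pos by (cases i) auto
    have "a (m, j) = a (m - 1, Suc j) \<and> (m, j) \<notin> U \<and> left_edge a U m (Suc j)"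
    proof (rule ccontr)
      assume no: "\<not> ?thesis"
      have "\<exists>S. (m, j) \<in> S \<and> (m, Suc j) \<notin> S \<and> (\<forall>p\<in>S. fst p \<le> m) \<and>
         (\<forall>(u, v)\<in>edges (pattern_of n a U). fst u \<le> m \<longrightarrow> (u \<in> S \<longleftrightarrow> v \<in> S))"
        by (rule cut_between_neighbors[OF a U]) (use no i pos eq in auto)
      then show False using path_connected_upto_closed[OF pc] i by auto
    qed
    then show ?thesis using i eq by simp
  qed
  then show "p \<in> circ ?P \<and> (p, upper_left p) \<in> edges ?P \<and> (p, upper_right p) \<in> edges ?P"
    using p eq nU by (auto simp: pattern_of_def lower_positions_iff positions_def)
qed

lemma pattern_of_E3:
  assumes a: "a \<in> GZ n lam" and U: "U \<subseteq> Free n a"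
  shows "E3 n (pattern_of n a U)"
  unfolding E3_def
proof (intro allI impI)
  fix i j assume ij: "1 \<le> i \<and> i + 2 \<le> n \<and> 1 \<le> j \<and> i + j + 1 \<le> n"
  have low: "(i, j) \<in> lower_positions n" "(i, Suc j) \<in> lower_positions n"
      "(Suc i, j) \<in> lower_positions n"
    using ij by (auto simp: lower_positions_iff)
  let ?l = "a (i, j) = a (i - 1, Suc j) \<and> (i, j) \<notin> U \<and> left_edge a U i (Suc j)"
  let ?r = "left_edge a U (Suc i) j \<and> a (Suc i, j) = a (i, Suc j) \<and> (Suc i, j) \<notin> U"
  have "?l \<longleftrightarrow> ?r"
  proof
    assume l: ?l
    then have "a (i, Suc j) = a (i - 1, Suc j)" using left_edgeD by blast
    then have "a (Suc i, j) = a (i, j)" "a (i, j) = a (i, Suc j)"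
      using l GZ_interlacing[OF a low(3)] by auto
    then show ?r using l not_marked[OF U, of "Suc i" j] by auto
  qed (use ij in auto)
  then show "((i, j), i - 1, j + 1) \<in> edges (pattern_of n a U) \<and>
        ((i, j + 1), i - 1, j + 1) \<in> edges (pattern_of n a U) \<longleftrightarrow>
        ((i + 1, j), i, j) \<in> edges (pattern_of n a U) \<and>
        ((i + 1, j), i, j + 1) \<in> edges (pattern_of n a U)"
    using low left_in_edges_pattern_of[of "Suc i" j n a U]
      right_in_edges_pattern_of[of "Suc i" j n a U]
    by (simp add: left_in_edges_pattern_of right_in_edges_pattern_of)
qed

lemma pattern_of_in_Pplus:
  assumes a: "a \<in> GZ n lam" and U: "U \<subseteq> Free n a"
  shows "pattern_of n a U \<in> Pplus n lam"
proof -
  let ?P = "pattern_of n a U"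
  have low_pos: "lower_positions n \<subseteq> positions n" by (auto simp: lower_positions_def)
  have nU: "(i, j) \<notin> U" if "a (i, j) = a (i - 1, j)" for i j
    using not_marked[OF U that] .
  have left: "left_edge a U i j" if "i \<ge> 1" "a (i, j) = a (i - 1, j)" "i = 1 \<or> a (i - 1, j) < a (i - 1, Suc j)" for i j
    using that by (cases i) auto
  have "enhancement n ?P"
    by (auto simp: enhancement_def pattern_of_def)
  moreover have "E1 n ?P"
    using U by (auto simp: E1_def positions_def Free_def lower_positions_def)
  moreover have "E2 n ?P"
    using low_pos nU by (auto simp: E2_def pattern_of_def dest: left_edgeD)
  moreover have "E4 n ?P"
    unfolding E4_def
  proof (intro allI impI)
    fix j assume j: "1 \<le> j \<and> j + 1 \<le> n \<and> entry ?P (0, j) = entry ?P (0, j + 1)"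
    then have low: "(1, j) \<in> lower_positions n" by (auto simp: lower_positions_iff)
    have eq: "a (1, j) = a (0, j)" "a (1, j) = a (0, Suc j)"
      using GZ_interlacing[OF a low] j by auto
    then show "(1, j) \<in> circ ?P \<and> ((1, j), 0, j) \<in> edges ?P \<and> ((1, j), 0, j + 1) \<in> edges ?P"
      using low low_pos nU[of 1 j] left_in_edges_pattern_of[of 1 j n a U]
        right_in_edges_pattern_of[of 1 j n a U] left[of 1 j] by auto
  qed
  moreover have "E5 n ?P"
    using low_pos nU left
    by (fastforce simp: E5_def left_in_edges_pattern_of lower_positions_iff)
  moreover have "E6 n ?P" "\<not> inefficient n ?P" "E8 n ?P"
    using nU by (auto simp: E6_def E8_def inefficient_def right_in_edges_pattern_of)
  ultimately show ?thesis
    using a pattern_of_E3[OF a U] pattern_of_E7[OF a U]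
    by (simp add: Pplus_def enhanced_patterns_def)
qed

lemma Psi_pattern_of:
  assumes "U \<subseteq> Free n a"
  shows "Psi n (pattern_of n a U) = (a, U)"
  using assms by (auto simp: Psi_def Free_def lower_positions_def)

text \<open>
  The edges are determined from the top row downwards: the right ones by (E2), (E6) and efficiency,
  the left ones by (E2), (E4), (E5) and the equivalence (E3), which relates them to the row above.
\<close>

lemma pattern_of_Psi:
  assumes P: "P \<in> Pplus n lam"
  shows "pattern_of n (entry P) (positions n - circ P) = P"
proof -
  define a where "a = entry P"
  define U where "U = positions n - circ P"
  have a: "a \<in> GZ n lam" and en: "enhancement n P" and
    E: "E1 n P" "E2 n P" "E3 n P" "E4 n P" "E5 n P" "E6 n P" "E7 n P" "E8 n P"
    and eff: "\<not> inefficient n P"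
    using P by (auto simp: Pplus_def enhanced_patterns_def a_def)
  have UF: "U \<subseteq> Free n a"
    using Psi_in_NN[OF P] by (simp add: Psi_def NN_def U_def a_def)
  have nU: "(i, j) \<notin> U" if "a (i, j) = a (i - 1, j)" for i j
    using not_marked[OF UF that] .
  have circ: "circ P = positions n - U" "circ P \<subseteq> positions n"
    using en by (auto simp: enhancement_def U_def)
  have right: "((i, j), (i - 1, Suc j)) \<in> edges P \<longleftrightarrow> a (i, j) = a (i - 1, Suc j) \<and> (i, j) \<notin> U"
    if low: "(i, j) \<in> lower_positions n" for i j
  proof
    assume "((i, j), (i - 1, Suc j)) \<in> edges P"
    then show "a (i, j) = a (i - 1, Suc j) \<and> (i, j) \<notin> U"
      using E(2) by (auto simp: E2_def a_def U_def)
  next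
    assume r: "a (i, j) = a (i - 1, Suc j) \<and> (i, j) \<notin> U"
    then have c: "(i, j) \<in> circ P" using low by (auto simp: circ lower_positions_def)
    show "((i, j), (i - 1, Suc j)) \<in> edges P"
    proof (cases "a (i - 1, j) = a (i, j)")
      case True
      then show ?thesis using r low eff by (force simp: inefficient_def a_def)
    next
      case False
      then have "a (i - 1, j) < a (i - 1, Suc j)"
        using GZ_interlacing[OF a low] by linarith
      then show ?thesis using E(6) r low c by (force simp: E6_def a_def)
    qed
  qed
  have left: "((i, j), (i - 1, j)) \<in> edges P \<longleftrightarrow> left_edge a U i j"
    if low: "(i, j) \<in> lower_positions n" for i j
    using low
  proof (induction i arbitrary: j)
    case 0
    then show ?case by (simp add: lower_positions_iff)
  next
    case (Suc i)
    show ?case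
    proof (cases "a (Suc i, j) = a (i, j)")
      case False
      then show ?thesis using E(2) by (auto simp: E2_def a_def)
    next
      case eq: True
      show ?thesis
      proof (cases "a (i, j) < a (i, Suc j)")
        case True
        then show ?thesis using E(5) eq Suc.prems by (force simp: E5_def a_def)
      next
        case False
        then have tri: "a (i, j) = a (i, Suc j)"
          using GZ_interlacing[OF a Suc.prems] eq by simp
        show ?thesis
        proof (cases "i = 0")
          case True
          then show ?thesis using E(4) tri eq Suc.prems
            by (auto simp: E4_def a_def lower_positions_iff)
        next
          case i: False
          have ij: "1 \<le> i \<and> i + 2 \<le> n \<and> 1 \<le> j \<and> i + j + 1 \<le> n"
            using Suc.prems i by (auto simp: lower_positions_iff)
          have low': "(i, j) \<in> lower_positions n" "(i, Suc j) \<in> lower_positions n"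
            using ij by (auto simp: lower_positions_iff)
          have "((Suc i, j), (i, Suc j)) \<in> edges P"
            using right[OF Suc.prems] eq tri nU[of "Suc i" j] by simp
          then have "((Suc i, j), (i, j)) \<in> edges P \<longleftrightarrow>
              ((i, j), (i - 1, Suc j)) \<in> edges P \<and> ((i, Suc j), (i - 1, Suc j)) \<in> edges P"
            using E(3)[unfolded E3_def, rule_format, OF ij] by auto
          also have "\<dots> \<longleftrightarrow> left_edge a U (Suc i) j"
            using right[OF low'(1)] Suc.IH[OF low'(2)] eq tri i by auto
          finally show ?thesis by simp
        qed
      qed
    qed
  qed
  have "e \<in> edges P \<longleftrightarrow> e \<in> edges (pattern_of n a U)" for e
  proof -
    obtain i j q where e: "e = ((i, j), q)" by (metis surj_pair)
    show ?thesis
    proof (cases "(i, j) \<in> lower_positions n \<and> (q = (i - 1, j) \<or> q = (i - 1, Suc j))")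
      case True
      then show ?thesis
        using left[of i j] right[of i j] unfolding e
        by (auto simp: left_in_edges_pattern_of right_in_edges_pattern_of)
    next
      case False
      have "e \<notin> edges P" using en False by (auto simp: enhancement_def e)
      moreover have "e \<notin> edges (pattern_of n a U)" using False by (auto simp: pattern_of_def e)
      ultimately show ?thesis by simp
    qed
  qed
  then have "edges (pattern_of n a U) = edges P" by blast
  then have "pattern_of n a U = P"
    by (intro enh_pattern.equality) (auto simp: circ a_def)
  then show ?thesis by (simp add: a_def U_def)
qed

lemma bij_betw_pattern_of:
  "bij_betw (\<lambda>(a, U). pattern_of n a U) (NN n lam) (Pplus n lam)"
proof (rule bij_betw_byWitness[where f' = "Psi n"])
  show "\<forall>x\<in>NN n lam. Psi n ((\<lambda>(a, U). pattern_of n a U) x) = x"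
    using Psi_pattern_of by (auto simp: NN_def)
  show "\<forall>P\<in>Pplus n lam. (\<lambda>(a, U). pattern_of n a U) (Psi n P) = P"
    using pattern_of_Psi by (simp add: Psi_def)
  show "(\<lambda>(a, U). pattern_of n a U) ` NN n lam \<subseteq> Pplus n lam"
    using pattern_of_in_Pplus by (auto simp: NN_def)
  show "Psi n ` Pplus n lam \<subseteq> NN n lam" using Psi_in_NN by blast
qed

section \<open>Set-valued tableaux as marked patterns\<close>

text \<open>
  Part \<open>r\<close> of the \<open>k\<close>-th partition of the chain belonging to a pattern. The value \<open>0\<close> for \<open>r > k\<close> makes
  the interlacing inequalities hold for all \<open>r \<ge> 1\<close>.
\<close>

definition chain_part :: "nat \<Rightarrow> pattern \<Rightarrow> nat \<Rightarrow> nat \<Rightarrow> nat" where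
  "chain_part n a k r = (if 1 \<le> r \<and> r \<le> k \<and> k \<le> n then nat (a (n - k, k - r + 1)) else 0)"

definition chain_mark :: "nat \<Rightarrow> (nat \<times> nat) set \<Rightarrow> nat \<Rightarrow> nat \<Rightarrow> bool" where
  "chain_mark n U k r \<longleftrightarrow> 1 \<le> r \<and> r \<le> k \<and> k < n \<and> (n - k, k - r + 1) \<in> U"

text \<open>
  The letter \<open>m\<close> is the minimum of the cells added in step \<open>m\<close> of the chain, and a mark puts it in
  addition into the last cell of row \<open>r\<close> that was present before that step.
\<close>

definition tableau_of :: "nat \<Rightarrow> (nat \<Rightarrow> nat) \<Rightarrow> pattern \<Rightarrow> (nat \<times> nat) set \<Rightarrow> tableau" where
  "tableau_of n lam a U = restrict (\<lambda>(r, c). {m \<in> {1..n}. c \<le> chain_part n a m r \<and>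
     (chain_part n a (m - 1) r < c \<or>
      chain_part n a (m - 1) r = c \<and> chain_mark n U (m - 1) r)}) (cells n lam)"

lemma GZ_nonneg:
  assumes "a \<in> GZ n lam" "(i, j) \<in> positions n"
  shows "0 \<le> a (i, j)"
  using assms(2)
proof (induction i arbitrary: j)
  case 0
  then show ?case using assms(1) by (auto simp: GZ_def positions_def)
next
  case (Suc i)
  then have "(Suc i, j) \<in> lower_positions n" "(i, j) \<in> positions n"
    by (auto simp: positions_def lower_positions_def)
  then show ?case using Suc.IH[of j] GZ_interlacing(1)[OF assms(1), of "Suc i" j] by simp
qed

lemma int_chain_part:
  assumes "a \<in> GZ n lam" "1 \<le> r" "r \<le> k" "k \<le> n"
  shows "int (chain_part n a k r) = a (n - k, k - r + 1)"
proof -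
  have "(n - k, k - r + 1) \<in> positions n" using assms by (auto simp: positions_def)
  then show ?thesis using GZ_nonneg[OF assms(1)] assms(2-) by (simp add: chain_part_def)
qed

lemma chain_part_mono_Suc:
  assumes a: "a \<in> GZ n lam" and k: "k < n"
  shows "chain_part n a k r \<le> chain_part n a (Suc k) r"
proof (cases "1 \<le> r \<and> r \<le> k")
  case True
  then have low: "(n - k, k - r + 1) \<in> lower_positions n"
    using k by (auto simp: lower_positions_iff)
  have e: "Suc k - r + 1 = Suc (k - r + 1)" "n - Suc k = n - k - 1"
    using True by auto
  have "int (chain_part n a k r) \<le> int (chain_part n a (Suc k) r)"
    using GZ_interlacing(2)[OF a low] int_chain_part[OF a, of r k] int_chain_part[OF a, of r "Suc k"]
      True k unfolding e by simp
  then show ?thesis by simp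
next
  case False
  then have "chain_part n a k r = 0" by (auto simp: chain_part_def)
  then show ?thesis by simp
qed

lemma chain_part_mono:
  assumes a: "a \<in> GZ n lam" and kl: "k \<le> l" "l \<le> n"
  shows "chain_part n a k r \<le> chain_part n a l r"
  using kl
proof (induction l rule: dec_induct)
  case (step l)
  then show ?case using chain_part_mono_Suc[OF a, of l r] by simp
qed simp

text \<open>
  Both parts read off the comparison of an entry with its upper left neighbor; the strict one is the
  freeness of marked positions.
\<close>

lemma chain_part_interlace:
  assumes a: "a \<in> GZ n lam" and k: "k < n" and r: "1 \<le> r"
  shows "chain_part n a (Suc k) (Suc r) \<le> chain_part n a k r"
    and "U \<subseteq> Free n a \<Longrightarrow> chain_mark n U k r \<Longrightarrow> chain_part n a (Suc k) (Suc r) < chain_part n a k r"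
proof -
  have *: "int (chain_part n a k r) = a (n - k, k - r + 1)"
    "int (chain_part n a (Suc k) (Suc r)) = a (n - k - 1, k - r + 1)"
    if "r \<le> k"
    using int_chain_part[OF a, of r k] int_chain_part[OF a, of "Suc r" "Suc k"] that k r by auto
  show "chain_part n a (Suc k) (Suc r) \<le> chain_part n a k r"
  proof (cases "r \<le> k")
    case True
    then have low: "(n - k, k - r + 1) \<in> lower_positions n"
      using k r by (auto simp: lower_positions_iff)
    show ?thesis using GZ_interlacing(1)[OF a low] *[OF True] by simp
  qed (simp add: chain_part_def)
  assume "U \<subseteq> Free n a" "chain_mark n U k r"
  then have "r \<le> k" "a (n - k, k - r + 1) > a (n - k - 1, k - r + 1)"
    by (auto simp: chain_mark_def Free_def)
  then show "chain_part n a (Suc k) (Suc r) < chain_part n a k r" using * by simp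
qed

lemma chain_part_0 [simp]: "chain_part n a 0 r = 0"
  by (simp add: chain_part_def)

lemma chain_part_top:
  assumes "a \<in> GZ n lam" "1 \<le> r" "r \<le> n"
  shows "chain_part n a n r = lam r"
proof -
  have "a (0, n - r + 1) = int (lam (n + 1 - (n - r + 1)))"
    using assms by (auto simp: GZ_def)
  moreover have "n + 1 - (n - r + 1) = r" using assms by auto
  ultimately show ?thesis using assms by (simp add: chain_part_def)
qed

lemma GZ_eqI:
  assumes "a \<in> GZ n lam" "b \<in> GZ n lam"
    and eq: "\<And>k r. 1 \<le> r \<Longrightarrow> r \<le> k \<Longrightarrow> k \<le> n \<Longrightarrow> chain_part n a k r = chain_part n b k r"
  shows "a = b"
proof (rule PiE_ext)
  show "a \<in> positions n \<rightarrow>\<^sub>E UNIV" "b \<in> positions n \<rightarrow>\<^sub>E UNIV"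
    using assms by (auto simp: GZ_def)
  fix p assume p: "p \<in> positions n"
  obtain i j where [simp]: "p = (i, j)" by fastforce
  define k r where "k = n - i" and "r = k - j + 1"
  have kr: "1 \<le> r" "r \<le> k" "k \<le> n" "n - k = i" "k - r + 1 = j"
    using p by (auto simp: positions_def k_def r_def)
  show "a p = b p"
    using int_chain_part[OF assms(1) kr(1-3)] int_chain_part[OF assms(2) kr(1-3)] eq[OF kr(1-3)]
    unfolding kr by simp
qed

lemma mem_tableau_of:
  assumes rc: "(r, c) \<in> cells n lam"
  shows "m \<in> tableau_of n lam a U (r, c) \<longleftrightarrow> 1 \<le> m \<and> m \<le> n \<and> c \<le> chain_part n a m r \<and>
     (chain_part n a (m - 1) r < c \<or>
      chain_part n a (m - 1) r = c \<and> chain_mark n U (m - 1) r)"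
  using rc by (auto simp: tableau_of_def)

lemma finite_tableau_of:
  assumes "p \<in> cells n lam"
  shows "finite (tableau_of n lam a U p)"
  using assms by (auto simp: tableau_of_def split: prod.splits)

text \<open>
  The first step of the chain at which the cell \<open>(r, c)\<close> is present contributes its number as a letter,
  and no smaller letter occurs. Hence the chain of shapes of \<open>tableau_of\<close> is the given one.
\<close>

lemma ex_mem_tableau_of_le_iff:
  assumes a: "a \<in> GZ n lam" and rc: "(r, c) \<in> cells n lam" and k: "k \<le> n"
  shows "(\<exists>m\<in>tableau_of n lam a U (r, c). m \<le> k) \<longleftrightarrow> c \<le> chain_part n a k r"
proof
  assume "\<exists>m\<in>tableau_of n lam a U (r, c). m \<le> k"
  then show "c \<le> chain_part n a k r"
    using chain_part_mono[OF a _ k] mem_tableau_of[OF rc] le_trans by metis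
next
  assume c: "c \<le> chain_part n a k r"
  define m where "m = (LEAST m. c \<le> chain_part n a m r)"
  have m: "c \<le> chain_part n a m r" "m \<le> k"
    unfolding m_def using c by (auto intro: LeastI Least_le)
  have "c \<ge> 1" using rc by (simp add: cells_def)
  then have "m \<noteq> 0" using m(1) by (intro notI) simp
  then have "\<not> c \<le> chain_part n a (m - 1) r"
    using not_less_Least[of "m - 1" "\<lambda>m. c \<le> chain_part n a m r"] by (simp add: m_def)
  then show "\<exists>m\<in>tableau_of n lam a U (r, c). m \<le> k"
    using m k \<open>m \<noteq> 0\<close> by (intro bexI[of _ m]) (auto simp: mem_tableau_of[OF rc])
qed

lemma tableau_of_nonempty:
  assumes a: "a \<in> GZ n lam" and rc: "(r, c) \<in> cells n lam"
  shows "tableau_of n lam a U (r, c) \<noteq> {}"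
proof -
  have "c \<le> chain_part n a n r" using rc chain_part_top[OF a] by (auto simp: cells_def)
  then show ?thesis using ex_mem_tableau_of_le_iff[OF a rc, of n U] by auto
qed

lemma Min_tableau_of_le_iff:
  assumes a: "a \<in> GZ n lam" and rc: "(r, c) \<in> cells n lam" and k: "k \<le> n"
  shows "Min (tableau_of n lam a U (r, c)) \<le> k \<longleftrightarrow> c \<le> chain_part n a k r"
  using ex_mem_tableau_of_le_iff[OF assms]
  by (simp add: Min_le_iff finite_tableau_of[OF rc] tableau_of_nonempty[OF a rc])

text \<open>
  Along rows, a letter \<open>m\<close> at column \<open>c\<close> means that row \<open>r\<close> had length at most \<open>c\<close> before step \<open>m\<close>, so
  the next cell arrives at step \<open>m\<close> or later. Down columns, the interlacing inequality suffices unless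
  \<open>m\<close> comes from a mark, and then its strict form does.
\<close>

lemma tableau_of_in_SVT:
  assumes a: "a \<in> GZ n lam" and U: "U \<subseteq> Free n a"
  shows "tableau_of n lam a U \<in> SVT n lam"
proof -
  let ?T = "tableau_of n lam a U"
  have "?T \<in> cells n lam \<rightarrow>\<^sub>E {S. S \<noteq> {} \<and> S \<subseteq> {1..n}}"
    using tableau_of_nonempty[OF a] mem_tableau_of
    by (auto simp: tableau_of_def PiE_iff)
  moreover have "Max (?T (r, c)) \<le> Min (?T (r, c + 1))"
    if rc: "(r, c) \<in> cells n lam" "(r, c + 1) \<in> cells n lam" for r c
  proof -
    have rc': "(r, Suc c) \<in> cells n lam" using rc by simp
    have "m \<le> m'" if m: "m \<in> ?T (r, c)" "m' \<in> ?T (r, c + 1)" for m m'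
    proof (rule ccontr)
      assume "\<not> m \<le> m'"
      then have "chain_part n a m' r \<le> chain_part n a (m - 1) r"
        using m by (intro chain_part_mono[OF a]) (auto simp: mem_tableau_of rc)
      then show False using m by (auto simp: mem_tableau_of rc rc')
    qed
    then show ?thesis
      using finite_tableau_of tableau_of_nonempty[OF a] rc by simp
  qed
  moreover have "Max (?T (r, c)) < Min (?T (r + 1, c))"
    if rc: "(r, c) \<in> cells n lam" "(r + 1, c) \<in> cells n lam" for r c
  proof -
    have "m < m'" if m: "m \<in> ?T (r, c)" "m' \<in> ?T (r + 1, c)" for m m'
    proof (rule ccontr)
      assume "\<not> m < m'"
      obtain k where k: "m = Suc k" "k < n"
        using m(1) by (cases m) (auto simp: mem_tableau_of rc)
      have r: "1 \<le> r" using rc by (simp add: cells_def)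
      have "chain_part n a m' (Suc r) \<le> chain_part n a m (Suc r)"
        using k \<open>\<not> m < m'\<close> by (intro chain_part_mono[OF a]) auto
      then have "c \<le> chain_part n a (Suc k) (Suc r)"
        using m(2) rc(2) k by (auto simp: mem_tableau_of)
      moreover have "chain_part n a k r < c \<or> chain_part n a k r = c \<and> chain_mark n U k r"
        using m(1) rc(1) k by (auto simp: mem_tableau_of)
      ultimately show False
        using chain_part_interlace[OF a k(2) r] U by (metis leD le_less_trans order_less_le_trans)
    qed
    then show ?thesis
      using finite_tableau_of tableau_of_nonempty[OF a] rc by simp
  qed
  ultimately show ?thesis by (simp add: SVT_def)
qed

lemma SVT_cell:
  assumes "T \<in> SVT n lam" "p \<in> cells n lam"
  shows "T p \<noteq> {}" "T p \<subseteq> {1..n}" "finite (T p)"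
proof -
  show "T p \<noteq> {}" "T p \<subseteq> {1..n}"
    using assms by (auto simp: SVT_def dest!: PiE_mem[OF _ assms(2)])
  then show "finite (T p)" using finite_subset by blast
qed

text \<open>
  Minima increase strictly down each column. Therefore the \<open>k\<close>-th shape has at most \<open>k\<close> rows.
\<close>

lemma SVT_row_le_Min:
  assumes lam: "antimono_on {1..n} lam" and T: "T \<in> SVT n lam" and "(r, c) \<in> cells n lam"
  shows "r \<le> Min (T (r, c))"
  using assms(3)
proof (induction r)
  case (Suc r)
  note T' = SVT_cell[OF T]
  show ?case
  proof (cases "r = 0")
    case True
    then show ?thesis using Min_in[OF T'(3,1)[OF Suc.prems]] T'(2)[OF Suc.prems] by auto
  next
    case False
    then have "lam (Suc r) \<le> lam r"
      using Suc.prems by (intro monotone_onD[OF lam]) (auto simp: cells_def)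
    then have rc: "(r, c) \<in> cells n lam" using Suc.prems False by (auto simp: cells_def)
    then have "Max (T (r, c)) < Min (T (Suc r, c))"
      using T Suc.prems by (auto simp: SVT_def)
    moreover have "Min (T (r, c)) \<le> Max (T (r, c))" using T'[OF rc] by simp
    ultimately show ?thesis using Suc.IH[OF rc] by simp
  qed
qed simp

lemma SVT_row_mono:
  assumes T: "T \<in> SVT n lam" and c: "(r, c) \<in> cells n lam" "(r, c') \<in> cells n lam" "c < c'"
  shows "Max (T (r, c)) \<le> Min (T (r, c'))"
proof -
  have "Suc c \<le> c'" using c by simp
  then show ?thesis using c(2)
  proof (induction c' rule: dec_induct)
    case base
    then show ?case using T c(1) by (auto simp: SVT_def)
  next
    case (step c')
    then have c': "(r, c') \<in> cells n lam" by (auto simp: cells_def)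
    then have "Max (T (r, c')) \<le> Min (T (r, Suc c'))"
      using step T by (auto simp: SVT_def)
    moreover have "Min (T (r, c')) \<le> Max (T (r, c'))" using SVT_cell[OF T c'] by simp
    ultimately show ?case using step.IH[OF c'] by simp
  qed
qed

text \<open>
  Minima increase weakly along rows, so the columns counted by \<open>nu\<close> form an initial segment and
  their number determines them.
\<close>

lemma Min_le_iff_nu:
  assumes T: "T \<in> SVT n lam" and rc: "(r, c) \<in> cells n lam"
  shows "Min (T (r, c)) \<le> k \<longleftrightarrow> c \<le> nu n lam T k r"
proof -
  define R where "R = {c. (r, c) \<in> cells n lam \<and> Min (T (r, c)) \<le> k}"
  have fin: "finite R" by (rule finite_subset[of _ "{1..lam r}"]) (auto simp: R_def cells_def)
  have nu: "nu n lam T k r = card R" by (simp add: nu_def R_def)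
  have down: "{1..d} \<subseteq> R" if "d \<in> R" for d
  proof
    fix e assume e: "e \<in> {1..d}"
    then have ec: "(r, e) \<in> cells n lam" using that by (auto simp: R_def cells_def)
    show "e \<in> R"
    proof (cases "e = d")
      case False
      then have "Max (T (r, e)) \<le> Min (T (r, d))"
        using that e ec by (intro SVT_row_mono[OF T]) (auto simp: R_def)
      moreover have "Min (T (r, e)) \<le> Max (T (r, e))" using SVT_cell[OF T ec] by simp
      ultimately show ?thesis using that ec by (auto simp: R_def)
    qed (use that in simp)
  qed
  show ?thesis
  proof
    assume "Min (T (r, c)) \<le> k"
    then have "{1..c} \<subseteq> R" using rc by (intro down) (simp add: R_def)
    then have "card {1..c} \<le> card R" by (rule card_mono[OF fin])
    then show "c \<le> nu n lam T k r" by (simp add: nu)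
  next
    assume le: "c \<le> nu n lam T k r"
    have "R \<subseteq> {1..<c}" if "c \<notin> R"
    proof
      fix d assume "d \<in> R"
      then show "d \<in> {1..<c}" using down[of d] that rc by (force simp: R_def cells_def)
    qed
    then have "c \<notin> R \<Longrightarrow> card R \<le> card {1..<c}" by (intro card_mono) auto
    then have "c \<in> R" using le rc by (cases "c \<in> R") (auto simp: nu cells_def)
    then show "Min (T (r, c)) \<le> k" by (simp add: R_def)
  qed
qed

lemma excessive_row_le:
  assumes lam: "antimono_on {1..n} lam" and T: "T \<in> SVT n lam" and "excessive n lam T k r"
  shows "r \<le> k"
proof -
  obtain c where c: "(r, c) \<in> cells n lam" "k + 1 \<in> T (r, c)" "k + 1 \<noteq> Min (T (r, c))"
    using assms(3) by (auto simp: excessive_def)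
  have "Min (T (r, c)) \<le> k" using Min_le[OF SVT_cell(3)[OF T c(1)] c(2)] c(3) by simp
  then show ?thesis using SVT_row_le_Min[OF lam T c(1)] by simp
qed

text \<open>
  The key to the injectivity of \<open>Phi\<close>: an excessive pair determines the cell that makes it excessive.
\<close>

lemma nonminimal_column:
  assumes T: "T \<in> SVT n lam"
    and c: "(r, c) \<in> cells n lam" "k + 1 \<in> T (r, c)" "k + 1 \<noteq> Min (T (r, c))"
  shows "nu n lam T k r = c"
proof (rule antisym)
  have "Min (T (r, c)) \<le> k" using Min_le[OF SVT_cell(3)[OF T c(1)] c(2)] c(3) by simp
  then show "c \<le> nu n lam T k r" using Min_le_iff_nu[OF T c(1)] by simp
  have "{d. (r, d) \<in> cells n lam \<and> Min (T (r, d)) \<le> k} \<subseteq> {1..c}"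
  proof
    fix d assume d: "d \<in> {d. (r, d) \<in> cells n lam \<and> Min (T (r, d)) \<le> k}"
    have "k + 1 \<le> Max (T (r, c))" using SVT_cell(3)[OF T c(1)] c(2) by simp
    then have "\<not> c < d" using SVT_row_mono[OF T c(1), of d] d by auto
    then show "d \<in> {1..c}" using d by (auto simp: cells_def)
  qed
  then have "nu n lam T k r \<le> card {1..c}" unfolding nu_def by (intro card_mono) auto
  then show "nu n lam T k r \<le> c" by simp
qed

lemma chain_part_chain_pattern:
  assumes lam: "antimono_on {1..n} lam" and T: "T \<in> SVT n lam" and k: "k \<le> n" and r: "1 \<le> r"
  shows "chain_part n (chain_pattern n lam T) k r = nu n lam T k r"
proof (cases "r \<le> k")
  case True
  have "(n - k, k - r + 1) \<in> positions n" "n - (n - k) = k" "k - (k - r + 1) + 1 = r"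
    using k r True by (auto simp: positions_def)
  then show ?thesis using k r True by (simp add: chain_part_def chain_pattern_def)
next
  case False
  have "{c. (r, c) \<in> cells n lam \<and> Min (T (r, c)) \<le> k} = {}"
    using SVT_row_le_Min[OF lam T] False by fastforce
  then have "nu n lam T k r = 0" unfolding nu_def by (simp only: card.empty)
  then show ?thesis using False by (simp add: chain_part_def)
qed

text \<open>
  The encoding of excessive pairs as positions loses nothing, because \<open>r \<le> k\<close> excludes truncation.
\<close>

lemma chain_mark_marked:
  assumes lam: "antimono_on {1..n} lam" and T: "T \<in> SVT n lam"
  shows "chain_mark n (marked n lam T) k r \<longleftrightarrow> excessive n lam T k r"
proof
  assume e: "excessive n lam T k r"
  then show "chain_mark n (marked n lam T) k r"
    using excessive_row_le[OF lam T e] by (auto simp: chain_mark_def marked_def excessive_def)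
next
  assume m: "chain_mark n (marked n lam T) k r"
  then obtain k' r' where e: "n - k = n - k'" "k - r + 1 = k' - r' + 1" "excessive n lam T k' r'"
    by (auto simp: chain_mark_def marked_def)
  have "r \<le> k" "k < n" "r' \<le> k'" "k' \<le> n - 1" "1 \<le> k'"
    using m e(3) excessive_row_le[OF lam T e(3)] by (auto simp: chain_mark_def excessive_def)
  then have "k = k'" "r = r'" using e(1,2) by auto
  then show "excessive n lam T k r" using e(3) by simp
qed

lemma tableau_of_Phi:
  assumes lam: "antimono_on {1..n} lam" and T: "T \<in> SVT n lam"
  shows "tableau_of n lam (chain_pattern n lam T) (marked n lam T) = T"
proof (rule ext)
  fix p
  let ?a = "chain_pattern n lam T" and ?U = "marked n lam T"
  have a: "?a \<in> GZ n lam" using Phi_in_NN[OF lam T] by (simp add: Phi_def NN_def)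
  show "tableau_of n lam ?a ?U p = T p"
  proof (cases "p \<in> cells n lam")
    case False
    have "T \<in> cells n lam \<rightarrow>\<^sub>E {S. S \<noteq> {} \<and> S \<subseteq> {1..n}}" using T by (simp add: SVT_def)
    from PiE_arb[OF this False] show ?thesis using False by (simp add: tableau_of_def)
  next
    case True
    obtain r c where [simp]: "p = (r, c)" by fastforce
    have rc: "(r, c) \<in> cells n lam" and r: "1 \<le> r" using True by (auto simp: cells_def)
    note T' = SVT_cell[OF T rc]
    have "m \<in> tableau_of n lam ?a ?U (r, c) \<longleftrightarrow> m \<in> T (r, c)" if m: "1 \<le> m" "m \<le> n" for m
    proof -
      obtain k where k: "m = Suc k" "k < n" using m by (cases m) auto
      have "m \<in> tableau_of n lam ?a ?U (r, c) \<longleftrightarrow> c \<le> nu n lam T (Suc k) r \<and>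
          (nu n lam T k r < c \<or> nu n lam T k r = c \<and> excessive n lam T k r)"
        using k r by (simp add: mem_tableau_of[OF rc] chain_part_chain_pattern[OF lam T]
            chain_mark_marked[OF lam T])
      also have "\<dots> \<longleftrightarrow> Min (T (r, c)) = Suc k \<or> nu n lam T k r = c \<and> excessive n lam T k r"
      proof -
        have "Min (T (r, c)) \<le> Suc k \<longleftrightarrow> c \<le> nu n lam T (Suc k) r"
          "Min (T (r, c)) \<le> k \<longleftrightarrow> c \<le> nu n lam T k r"
          by (rule Min_le_iff_nu[OF T rc])+
        then show ?thesis by linarith
      qed
      also have "\<dots> \<longleftrightarrow> Suc k \<in> T (r, c)"
      proof
        assume "Min (T (r, c)) = Suc k \<or> nu n lam T k r = c \<and> excessive n lam T k r"
        then show "Suc k \<in> T (r, c)"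
        proof
          assume "nu n lam T k r = c \<and> excessive n lam T k r"
          then obtain d where "(r, d) \<in> cells n lam" "k + 1 \<in> T (r, d)" "k + 1 \<noteq> Min (T (r, d))"
            and "nu n lam T k r = c" by (auto simp: excessive_def)
          then show ?thesis using nonminimal_column[OF T, of r d k] by simp
        qed (use Min_in[OF T'(3,1)] in simp)
      next
        assume k': "Suc k \<in> T (r, c)"
        show "Min (T (r, c)) = Suc k \<or> nu n lam T k r = c \<and> excessive n lam T k r"
        proof (cases "Min (T (r, c)) = Suc k")
          case ne: False
          have "1 \<le> Min (T (r, c))" using Min_in[OF T'(3,1)] T'(2) by auto
          then have "1 \<le> k" using Min_le[OF T'(3) k'] ne by simp
          then have "excessive n lam T k r"
            using k k' r rc ne by (auto simp: excessive_def)
          then show ?thesis using nonminimal_column[OF T rc, of k] k' ne by auto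
        qed simp
      qed
      finally show ?thesis using k by simp
    qed
    moreover have "tableau_of n lam ?a ?U (r, c) \<subseteq> {1..n}"
      using mem_tableau_of[OF rc] by auto
    ultimately show ?thesis using T'(2) by auto
  qed
qed

lemma Phi_tableau_of:
  assumes lam: "antimono_on {1..n} lam" and a: "a \<in> GZ n lam" and U: "U \<subseteq> Free n a"
  shows "Phi n lam (tableau_of n lam a U) = (a, U)"
proof -
  let ?T = "tableau_of n lam a U"
  have T: "?T \<in> SVT n lam" by (rule tableau_of_in_SVT[OF a U])
  have top: "chain_part n a k r \<le> lam r" if "1 \<le> r" "r \<le> n" "k \<le> n" for k r
    using chain_part_mono[OF a that(3) order_refl] chain_part_top[OF a that(1,2)] by metis
  have nu: "nu n lam ?T k r = chain_part n a k r" if "1 \<le> r" "r \<le> n" "k \<le> n" for k r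
  proof -
    have "{c. (r, c) \<in> cells n lam \<and> Min (?T (r, c)) \<le> k} = {1..chain_part n a k r}"
      using Min_tableau_of_le_iff[OF a _ that(3)] top[OF that] that by (auto simp: cells_def)
    then show ?thesis by (simp add: nu_def)
  qed
  have b: "chain_pattern n lam ?T \<in> GZ n lam"
    using Phi_in_NN[OF lam T] by (simp add: Phi_def NN_def)
  have "chain_pattern n lam ?T = a"
    by (rule GZ_eqI[OF b a]) (simp add: chain_part_chain_pattern[OF lam T] nu)
  moreover have "p \<in> marked n lam ?T \<longleftrightarrow> p \<in> U" for p
  proof -
    have ex: "excessive n lam ?T k r \<longleftrightarrow> chain_mark n U k r" for k r
    proof
      assume e: "excessive n lam ?T k r"
      then obtain c where c: "(r, c) \<in> cells n lam" "k + 1 \<in> ?T (r, c)" "k + 1 \<noteq> Min (?T (r, c))"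
        and k: "k \<le> n - 1" "1 \<le> k" by (auto simp: excessive_def)
      have r: "1 \<le> r" "r \<le> n" using c by (auto simp: cells_def)
      have "chain_part n a k r = c" using nonminimal_column[OF T c] nu[of r k] r k by simp
      then show "chain_mark n U k r" using c(2) by (simp add: mem_tableau_of[OF c(1)])
    next
      assume m: "chain_mark n U k r"
      then have kr: "k < n" "1 \<le> r" "r \<le> k" by (auto simp: chain_mark_def)
      define c where "c = chain_part n a k r"
      have "0 < c" using chain_part_interlace(2)[OF a kr(1,2) U m] by (simp add: c_def)
      then have rc: "(r, c) \<in> cells n lam"
        using kr top[of r k] by (simp add: cells_def c_def)
      have "k + 1 \<in> ?T (r, c)"
        using kr m chain_part_mono_Suc[OF a kr(1), of r] c_def
        unfolding mem_tableau_of[OF rc] by auto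
      moreover have "Min (?T (r, c)) \<le> k"
        using kr Min_tableau_of_le_iff[OF a rc, of k U] unfolding c_def by simp
      ultimately show "excessive n lam ?T k r"
        using kr rc by (auto simp: excessive_def)
    qed
    show ?thesis
    proof
      assume "p \<in> marked n lam ?T"
      then show "p \<in> U" unfolding marked_def ex by (auto simp: chain_mark_def)
    next
      assume p: "p \<in> U"
      obtain i j where ij [simp]: "p = (i, j)" by fastforce
      have "(i, j) \<in> lower_positions n" using p U by (auto simp: Free_def)
      then have "chain_mark n U (n - i) (n - i - j + 1)" "p = (n - (n - i), (n - i) - (n - i - j + 1) + 1)"
        using p by (auto simp: chain_mark_def lower_positions_iff)
      then show "p \<in> marked n lam ?T" unfolding marked_def ex by blast
    qed
  qed
  ultimately show ?thesis by (auto simp: Phi_def)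
qed

lemma bij_betw_Phi:
  assumes lam: "antimono_on {1..n} lam"
  shows "bij_betw (Phi n lam) (SVT n lam) (NN n lam)"
proof (rule bij_betw_byWitness[where f' = "\<lambda>(a, U). tableau_of n lam a U"])
  show "\<forall>T\<in>SVT n lam. (\<lambda>(a, U). tableau_of n lam a U) (Phi n lam T) = T"
    using tableau_of_Phi[OF lam] by (simp add: Phi_def)
  show "\<forall>x\<in>NN n lam. Phi n lam ((\<lambda>(a, U). tableau_of n lam a U) x) = x"
    using Phi_tableau_of[OF lam] by (auto simp: NN_def)
  show "Phi n lam ` SVT n lam \<subseteq> NN n lam" using Phi_in_NN[OF lam] by blast
  show "(\<lambda>(a, U). tableau_of n lam a U) ` NN n lam \<subseteq> SVT n lam"
    using tableau_of_in_SVT by (auto simp: NN_def)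
qed


section \<open>Comparison of the monomials\<close>

lemma finite_cells: "finite (cells n lam)"
  by (rule finite_subset[of _ "SIGMA r:{1..n}. {1..lam r}"]) (auto simp: cells_def)

lemma card_cells: "card (cells n lam) = (\<Sum>r\<in>{1..n}. lam r)"
proof -
  have "cells n lam = (SIGMA r:{1..n}. {1..lam r})" by (auto simp: cells_def)
  then show ?thesis by simp
qed

lemma sum_card_eq_sum_wt:
  assumes T: "T \<in> SVT n lam"
  shows "(\<Sum>p\<in>cells n lam. card (T p)) = (\<Sum>m\<in>{1..n}. wt n lam T m)"
proof -
  have "card (T p) = (\<Sum>m\<in>{1..n}. if m \<in> T p then 1 else 0)" if "p \<in> cells n lam" for p
  proof -
    have "T p = {m \<in> {1..n}. m \<in> T p}" using SVT_cell(2)[OF T that] by blast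
    then show ?thesis by (simp flip: sum.inter_filter)
  qed
  then have "(\<Sum>p\<in>cells n lam. card (T p)) =
      (\<Sum>p\<in>cells n lam. \<Sum>m\<in>{1..n}. if m \<in> T p then 1 else 0)" by simp
  also have "\<dots> = (\<Sum>m\<in>{1..n}. \<Sum>p\<in>cells n lam. if m \<in> T p then 1 else 0)"
    by (rule sum.swap)
  also have "\<dots> = (\<Sum>m\<in>{1..n}. wt n lam T m)"
    by (simp add: wt_def finite_cells flip: sum.inter_filter)
  finally show ?thesis .
qed

text \<open>
  In each row, the cells containing the letter \<open>k + 1\<close> are those added in step \<open>k + 1\<close> and, if there
  is a mark, the cell just before them.
\<close>

lemma wt_tableau_of:
  assumes a: "a \<in> GZ n lam" and U: "U \<subseteq> Free n a" and k: "k < n"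
  shows "int (wt n lam (tableau_of n lam a U) (Suc k)) =
    (\<Sum>r\<in>{1..n}. int (chain_part n a (Suc k) r)) - (\<Sum>r\<in>{1..n}. int (chain_part n a k r)) +
    int (card {r \<in> {1..n}. chain_mark n U k r})"
proof -
  let ?v = "chain_part n a" and ?T = "tableau_of n lam a U"
  define C where "C r = {?v k r<..?v (Suc k) r} \<union> (if chain_mark n U k r then {?v k r} else {})" for r
  have row: "(r, c) \<in> cells n lam \<and> Suc k \<in> ?T (r, c) \<longleftrightarrow> c \<in> C r" if r: "r \<in> {1..n}" for r c
  proof -
    have le: "?v k r \<le> ?v (Suc k) r" by (rule chain_part_mono_Suc[OF a k])
    have "?v (Suc k) r \<le> lam r"
      using chain_part_mono[OF a _ order_refl, of "Suc k" r] chain_part_top[OF a, of r] k r by simp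
    \<comment> \<open>The cell that receives a marked letter exists.\<close>
    moreover have "0 < ?v k r" if "chain_mark n U k r"
      using chain_part_interlace(2)[OF a k _ U that] r by simp
    ultimately show ?thesis
      using le k r mem_tableau_of[of r c n lam "Suc k" a U]
      by (auto simp: C_def cells_def)
  qed
  have card: "int (card (C r)) =
      int (?v (Suc k) r) - int (?v k r) + (if chain_mark n U k r then 1 else 0)" for r
    using chain_part_mono_Suc[OF a k, of r] by (simp add: C_def)
  have "{p \<in> cells n lam. Suc k \<in> ?T p} = (SIGMA r:{1..n}. C r)"
  proof -
    have "p \<in> cells n lam \<and> Suc k \<in> ?T p \<longleftrightarrow> p \<in> (SIGMA r:{1..n}. C r)" for p
      using row[of "fst p" "snd p"] by (cases p) (auto simp: cells_def)
    then show ?thesis by blast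
  qed
  then have "wt n lam ?T (Suc k) = (\<Sum>r\<in>{1..n}. card (C r))"
    by (simp add: wt_def C_def)
  then have "int (wt n lam ?T (Suc k)) = (\<Sum>r\<in>{1..n}. int (card (C r)))" by simp
  then show ?thesis
    by (simp add: card sum.distrib sum_subtractf flip: sum.inter_filter)
qed

lemma row_sum_eq_sum_chain_part:
  assumes a: "entry P \<in> GZ n lam" and k: "k \<le> n"
  shows "row_sum n P (n - k) = (\<Sum>r\<in>{1..n}. int (chain_part n (entry P) k r))"
proof -
  have "row_sum n P (n - k) = (\<Sum>r\<in>{1..k}. int (chain_part n (entry P) k r))"
    unfolding row_sum_def
    by (rule sum.reindex_bij_witness[of _ "\<lambda>r. k - r + 1" "\<lambda>j. k - j + 1"])
      (use k in \<open>auto simp: int_chain_part[OF a]\<close>)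
  also have "\<dots> = (\<Sum>r\<in>{1..n}. int (chain_part n (entry P) k r))"
    by (rule sum.mono_neutral_left) (use k in \<open>auto simp: chain_part_def\<close>)
  finally show ?thesis .
qed

lemma row_free_pattern_of:
  assumes "k < n"
  shows "row_free n (pattern_of n a U) (n - k) = card {r \<in> {1..n}. chain_mark n U k r}"
  unfolding row_free_def
  by (rule bij_betw_same_card[of "\<lambda>j. k - j + 1"],
      rule bij_betw_byWitness[where f' = "\<lambda>r. k - r + 1"])
    (use assms in \<open>auto simp: chain_mark_def positions_def Suc_diff_le\<close>)

lemma xdeg_pattern_of:
  assumes a: "a \<in> GZ n lam" and U: "U \<subseteq> Free n a" and m: "m \<in> {1..n}"
  shows "xdeg n (pattern_of n a U) m = int (wt n lam (tableau_of n lam a U) m)"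
proof -
  obtain k where k: "m = Suc k" "k < n" using m by (cases m) auto
  have i: "n + 1 - m = n - k" "n - k - 1 = n - Suc k" using k by auto
  show ?thesis
    unfolding xdeg_def Let_def i
    using k row_sum_eq_sum_chain_part[of "pattern_of n a U" n lam] a
    by (simp add: row_free_pattern_of wt_tableau_of[OF a U])
qed

text \<open>
  Row \<open>0\<close> is encircled and row \<open>n\<close> is empty, so the sum may run over \<open>1, \<dots>, n\<close>, the rows that occur
  in the exponents \<open>xdeg\<close>.
\<close>

lemma rk_eq_sum_row_free:
  assumes "E1 n P"
  shows "rk n P = (\<Sum>i\<in>{1..n}. row_free n P i)"
proof -
  have "positions n - circ P = (SIGMA i:{1..n}. {j \<in> {1..n - i}. (i, j) \<notin> circ P})"
  proof -
    have "p \<in> positions n - circ P \<longleftrightarrow>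
        p \<in> (SIGMA i:{1..n}. {j \<in> {1..n - i}. (i, j) \<notin> circ P})" for p
      using assms by (cases p; cases "fst p = 0") (auto simp: positions_def E1_def)
    then show ?thesis by blast
  qed
  then show ?thesis by (simp add: rk_def row_free_def)
qed

text \<open>
  The excess is the sum of all weights minus the number of cells. The sum of the corresponding
  exponents \<open>xdeg\<close> telescopes to the sum of row \<open>0\<close>, which is the number of cells, plus the rank.
\<close>

lemma excess_tableau_of:
  assumes a: "a \<in> GZ n lam" and U: "U \<subseteq> Free n a"
  shows "excess n lam (tableau_of n lam a U) = rk n (pattern_of n a U)"
proof -
  let ?T = "tableau_of n lam a U" and ?P = "pattern_of n a U"
  have T: "?T \<in> SVT n lam" by (rule tableau_of_in_SVT[OF a U])
  have P: "E1 n ?P" using pattern_of_in_Pplus[OF a U] by (simp add: Pplus_def enhanced_patterns_def)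
  have "int (excess n lam ?T) = (\<Sum>p\<in>cells n lam. int (card (?T p)) - 1)"
    unfolding excess_def of_nat_sum
  proof (rule sum.cong)
    fix p assume "p \<in> cells n lam"
    then have "0 < card (?T p)" using SVT_cell[OF T] by (simp add: card_gt_0_iff)
    then show "int (card (?T p) - 1) = int (card (?T p)) - 1" by simp
  qed simp
  also have "\<dots> = int (\<Sum>p\<in>cells n lam. card (?T p)) - int (card (cells n lam))"
    by (simp add: sum_subtractf)
  also have "int (\<Sum>p\<in>cells n lam. card (?T p)) = (\<Sum>m\<in>{1..n}. xdeg n ?P m)"
    by (simp add: sum_card_eq_sum_wt[OF T] xdeg_pattern_of[OF a U])
  also have "\<dots> = (\<Sum>i\<in>{1..n}. row_sum n ?P (i - 1) - row_sum n ?P i + int (row_free n ?P i))"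
    unfolding xdeg_def Let_def
    by (rule sum.reindex_bij_witness[of _ "\<lambda>i. n + 1 - i" "\<lambda>i. n + 1 - i"]) auto
  also have "\<dots> = (\<Sum>i\<in>{1..n}. row_sum n ?P (i - 1) - row_sum n ?P i) + int (rk n ?P)"
    by (simp add: sum.distrib rk_eq_sum_row_free[OF P])
  also have "(\<Sum>i\<in>{1..n}. row_sum n ?P (i - 1) - row_sum n ?P i) = row_sum n ?P 0 - row_sum n ?P n"
    using sum_telescope''[of 0 n "\<lambda>i. - row_sum n ?P i"] by (simp add: sum_subtractf)
  also have "row_sum n ?P n = 0" by (simp add: row_sum_def)
  also have "row_sum n ?P 0 = int (card (cells n lam))"
    using row_sum_eq_sum_chain_part[of ?P n lam n] a by (simp add: card_cells chain_part_top[OF a])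
  finally show ?thesis by simp
qed

lemma xP_pattern_of:
  assumes a: "a \<in> GZ n lam" and U: "U \<subseteq> Free n a"
  shows "xP n (pattern_of n a U) =
    beta ^ excess n lam (tableau_of n lam a U) * xwt n lam (tableau_of n lam a U)"
  by (simp add: xP_def xwt_def xdeg_pattern_of[OF a U] excess_tableau_of[OF a U])


section \<open>The bijection\<close>

theorem corollary2:
  fixes n :: nat and lam :: "nat \<Rightarrow> nat"
  assumes "n \<ge> 1" and "antimono_on {1..n} lam"
  shows "(\<forall>T\<in>SVT n lam. \<exists>!P. P \<in> Pplus n lam \<and> Psi n P = Phi n lam T)
    \<and> bij_betw (Phi_tilde n lam) (SVT n lam) (Pplus n lam)
    \<and> (\<forall>T\<in>SVT n lam. xP n (Phi_tilde n lam T) = beta ^ excess n lam T * xwt n lam T)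
    \<and> (grothendieck n lam = (\<Sum>T\<in>SVT n lam. beta ^ excess n lam T * xwt n lam T) \<longleftrightarrow>
       grothendieck n lam = (\<Sum>P\<in>Pplus n lam. xP n P))"
proof -
  note lam = assms(2)
  define inv_Psi where "inv_Psi = (\<lambda>(a, U). pattern_of n a U)"
  have Psi_iff: "P \<in> Pplus n lam \<and> Psi n P = Phi n lam T \<longleftrightarrow> P = inv_Psi (Phi n lam T)"
    if T: "T \<in> SVT n lam" for P T
  proof -
    obtain a U where aU: "Phi n lam T = (a, U)" "a \<in> GZ n lam" "U \<subseteq> Free n a"
      using Phi_in_NN[OF lam T] by (auto simp: NN_def)
    show ?thesis
    proof
      assume "P \<in> Pplus n lam \<and> Psi n P = Phi n lam T"
      then show "P = inv_Psi (Phi n lam T)"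
        using pattern_of_Psi[of P n lam] by (simp add: inv_Psi_def aU(1) Psi_def)
    next
      assume "P = inv_Psi (Phi n lam T)"
      then show "P \<in> Pplus n lam \<and> Psi n P = Phi n lam T"
        using pattern_of_in_Pplus[OF aU(2,3)] Psi_pattern_of[OF aU(3)]
        by (simp add: inv_Psi_def aU(1))
    qed
  qed
  then have ex1: "\<forall>T\<in>SVT n lam. \<exists>!P. P \<in> Pplus n lam \<and> Psi n P = Phi n lam T" by simp
  have tilde: "Phi_tilde n lam T = inv_Psi (Phi n lam T)" if "T \<in> SVT n lam" for T
    by (simp add: Phi_tilde_def Psi_iff[OF that])
  from bij_betw_trans[OF bij_betw_Phi[OF lam] bij_betw_pattern_of]
  have bij: "bij_betw (Phi_tilde n lam) (SVT n lam) (Pplus n lam)"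
    by (subst bij_betw_cong[of _ _ "inv_Psi \<circ> Phi n lam"]) (simp_all add: tilde inv_Psi_def)
  have wt: "xP n (Phi_tilde n lam T) = beta ^ excess n lam T * xwt n lam T"
    if T: "T \<in> SVT n lam" for T
    using Phi_in_NN[OF lam T] xP_pattern_of[of "chain_pattern n lam T" n lam "marked n lam T"]
    by (simp add: tilde[OF T] inv_Psi_def Phi_def NN_def tableau_of_Phi[OF lam T])
  have "(\<Sum>T\<in>SVT n lam. beta ^ excess n lam T * xwt n lam T) = (\<Sum>P\<in>Pplus n lam. xP n P)"
    using sum.reindex_bij_betw[OF bij, of "xP n"] by (simp add: wt)
  then show ?thesis using ex1 bij wt by auto
qed

end
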